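(* Let $Q$ be the $q$-matrix on $\mathbf Z_+^n$ described in the context (resurrection rates equal to immigration rates), assumed conservative, with $\mathbf Z_+^n$ communicating and (A-1), (A-2), (A-3) holding. Let $P(t)=(p_{\mathbf{ij}}(t);\mathbf i,\mathbf j\in\mathbf Z_+^n)$ be the Feller minimal $Q$-function and $\lambda_Z$ the decay parameter of $\mathbf Z_+^n$. Then a $\lambda_Z$-invariant vector $(y_{\mathbf j};\mathbf j\in\mathbf Z_+^n)$ for $Q$ (and also for $P(t)$) on $\mathbf Z_+^n$ is given by $$y_{\mathbf j}=q_1^{j_1}\cdots q_n^{j_n},\qquad \mathbf j=(j_1,\dots,j_n)\in\mathbf Z_+^n,$$ where $(q_1,\dots,q_n)$ is the smallest nonnegative solution in $[0,1]^n$ of $B_1(u)=\dots=B_n(u)=0$.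
   Context: Fix $n\ge1$; $\mathbf e_k$ is the $k$-th unit vector and $\chi$ the indicator function of $\mathbf Z_+^n$. The (conservative) $q$-matrix is $$q_{\mathbf{ij}}=\sum_{k=1}^n i_k b^{(k)}_{\mathbf j-\mathbf i+\mathbf e_k}\chi(\mathbf j-\mathbf i+\mathbf e_k)+a_{\mathbf j-\mathbf i}\chi(\mathbf j-\mathbf i),\qquad \mathbf i,\mathbf j\in\mathbf Z_+^n,$$ with $a_{\mathbf j}\ge0$ $(\mathbf j\ne\mathbf 0)$, $0<\sum_{\mathbf j\ne\mathbf 0}a_{\mathbf j}=-a_{\mathbf 0}<\infty$, and for each $k$: $b^{(k)}_{\mathbf j}\ge0$ $(\mathbf j\ne\mathbf e_k)$, $0<\sum_{\mathbf j\ne\mathbf e_k}b^{(k)}_{\mathbf j}=-b^{(k)}_{\mathbf e_k}<\infty$. $B_k(u)=\sum_{\mathbf j}b^{(k)}_{\mathbf j}u_1^{j_1}\cdots u_n^{j_n}$ on $[0,1]^n$, $B_{ij}=\partial B_i/\partial u_j$, $g_{ij}=\delta_{ij}-B_{ij}/b^{(i)}_{\mathbf e_i}$, $G=(g_{ij})$. (A-1) $\{B_i\}$ is nonsingular: there is no $n\times n$ matrix $M$ with $(B_1(u),\dots,B_n(u))^{T}=M(u_1,\dots,u_n)^{T}$ for all $u$. (A-2) $B_{ij}(1,\dots,1)<\infty$ for all $i,j$. (A-3) $G(1,\dots,1)$ is positively regular (some power has all entries strictly positive). Decay parameter $\lambda_Z\ge0$: the number with $\frac1t\log p_{\mathbf{ij}}(t)\to-\lambda_Z$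 as $t\to\infty$ for all $\mathbf i,\mathbf j\in\mathbf Z_+^n$. A family $(y_{\mathbf j};\mathbf j\in\mathbf Z_+^n)$ of strictly positive numbers is a $\mu$-invariant vector for $Q$ on $\mathbf Z_+^n$ if $\sum_{\mathbf j}q_{\mathbf{ij}}y_{\mathbf j}=-\mu y_{\mathbf i}$ for all $\mathbf i$, and a $\mu$-invariant vector for $P(t)$ if $\sum_{\mathbf j}p_{\mathbf{ij}}(t)y_{\mathbf j}=e^{-\mu t}y_{\mathbf i}$ for all $\mathbf i$ and $t\ge0$. *)

theory Defs
  imports "HOL-Analysis.Analysis"
begin

type_synonym 'n state = "nat ^ 'n"

abbreviation unit_state :: "'n::finite \<Rightarrow> 'n state" where
  "unit_state k \<equiv> axis k 1"

definition immigration_rates :: "('n::finite state \<Rightarrow> real) \<Rightarrow> bool" where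
  "immigration_rates a \<longleftrightarrow>
     (\<forall>j. j \<noteq> 0 \<longrightarrow> a j \<ge> 0) \<and> (a has_sum (- a 0)) (UNIV - {0}) \<and> - a 0 > 0"

definition branching_rates :: "('n::finite \<Rightarrow> 'n state \<Rightarrow> real) \<Rightarrow> bool" where
  "branching_rates b \<longleftrightarrow>
     (\<forall>k. (\<forall>j. j \<noteq> unit_state k \<longrightarrow> b k j \<ge> 0) \<and>
          (b k has_sum (- b k (unit_state k))) (UNIV - {unit_state k}) \<and>
          - b k (unit_state k) > 0)"

text \<open>
  Subtraction on \<^typ>\<open>nat\<close> truncates, so the guards are essential: they play the
  role of the indicator function of the nonnegative orthant in the integer lattice.
\<close>
definition q_matrix ::
    "('n::finite state \<Rightarrow> real) \<Rightarrow> ('n \<Rightarrow> 'n state \<Rightarrow> real) \<Rightarrow> 'n state \<Rightarrow> 'n state \<Rightarrow> real" where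
  "q_matrix a b i j =
     (\<Sum>k\<in>UNIV. real (i $ k) *
        (if i \<le> j + unit_state k then b k (j + unit_state k - i) else 0))
     + (if i \<le> j then a (j - i) else 0)"

definition conservative :: "('s \<Rightarrow> 's \<Rightarrow> real) \<Rightarrow> bool" where
  "conservative Q \<longleftrightarrow>
     (\<forall>i j. i \<noteq> j \<longrightarrow> Q i j \<ge> 0) \<and> (\<forall>i. (Q i has_sum (- Q i i)) (UNIV - {i}))"

text \<open>
  Feller's construction: starting from zero, iterate the right-hand side of the backward
  integral equation
  \[ p_{ij}(t) = \delta_{ij} e^{q_{ii} t}
       + \int_0^t e^{q_{ii} s} \sum_{k \ne i} q_{ik}\, p_{kj}(t - s)\, ds. \]
  The iterates increase; the \<open>m\<close>-th one is the probability of being at \<open>j\<close> at time \<open>t\<close>,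
  starting from \<open>i\<close>, with fewer than \<open>m\<close> jumps. The sum over \<open>k\<close> is written as an
  integral over the counting measure.
\<close>
primrec feller_iter :: "('s \<Rightarrow> 's \<Rightarrow> real) \<Rightarrow> nat \<Rightarrow> real \<Rightarrow> 's \<Rightarrow> 's \<Rightarrow> ennreal" where
  "feller_iter Q 0 = (\<lambda>t i j. 0)"
| "feller_iter Q (Suc m) = (\<lambda>t i j.
     (if i = j then ennreal (exp (Q i i * t)) else 0)
     + (\<integral>\<^sup>+s\<in>{0..t}. ennreal (exp (Q i i * s)) *
          (\<integral>\<^sup>+k. ennreal (Q i k) * feller_iter Q m (t - s) k j \<partial>count_space (UNIV - {i}))
        \<partial>lborel))"

definition feller_minimal :: "('s \<Rightarrow> 's \<Rightarrow> real) \<Rightarrow> real \<Rightarrow> 's \<Rightarrow> 's \<Rightarrow> real" where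
  "feller_minimal Q t i j = enn2real (SUP m. feller_iter Q m t i j)"

definition communicating :: "(real \<Rightarrow> 's \<Rightarrow> 's \<Rightarrow> real) \<Rightarrow> bool" where
  "communicating P \<longleftrightarrow> (\<forall>i j. \<exists>t\<ge>0. P t i j > 0)"

definition is_decay_parameter :: "(real \<Rightarrow> 's \<Rightarrow> 's \<Rightarrow> real) \<Rightarrow> real \<Rightarrow> bool" where
  "is_decay_parameter P \<mu> \<longleftrightarrow>
     \<mu> \<ge> 0 \<and> (\<forall>i j. ((\<lambda>t. ln (P t i j) / t) \<longlongrightarrow> - \<mu>) at_top)"

definition invariant_vector_q :: "('s \<Rightarrow> 's \<Rightarrow> real) \<Rightarrow> real \<Rightarrow> ('s \<Rightarrow> real) \<Rightarrow> bool" where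
  "invariant_vector_q Q \<mu> y \<longleftrightarrow>
     (\<forall>j. y j > 0) \<and> (\<forall>i. ((\<lambda>j. Q i j * y j) has_sum (- \<mu> * y i)) UNIV)"

definition invariant_vector_transition ::
    "(real \<Rightarrow> 's \<Rightarrow> 's \<Rightarrow> real) \<Rightarrow> real \<Rightarrow> ('s \<Rightarrow> real) \<Rightarrow> bool" where
  "invariant_vector_transition P \<mu> y \<longleftrightarrow>
     (\<forall>j. y j > 0) \<and>
     (\<forall>i. \<forall>t\<ge>0. ((\<lambda>j. P t i j * y j) has_sum (exp (- \<mu> * t) * y i)) UNIV)"

definition monomial :: "real ^ 'n::finite \<Rightarrow> 'n state \<Rightarrow> real" where
  "monomial u j = (\<Prod>i\<in>UNIV. (u $ i) ^ (j $ i))"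

definition gen_fun :: "('n::finite \<Rightarrow> 'n state \<Rightarrow> real) \<Rightarrow> 'n \<Rightarrow> real ^ 'n \<Rightarrow> real" where
  "gen_fun b k u = (\<Sum>\<^sub>\<infinity>j. b k j * monomial u j)"

definition line_through :: "real ^ 'n::finite \<Rightarrow> 'n \<Rightarrow> real \<Rightarrow> real ^ 'n" where
  "line_through u j t = (\<chi> k. if k = j then t else u $ k)"

text \<open>
  The generating functions live on the closed unit cube only, so partial derivatives are
  taken relative to it: they are two-sided in the interior and one-sided at the corner
  \<open>(1, \<dots>, 1)\<close>.
\<close>
definition has_finite_partial :: "(real ^ 'n::finite \<Rightarrow> real) \<Rightarrow> 'n \<Rightarrow> real ^ 'n \<Rightarrow> bool" where
  "has_finite_partial f j u \<longleftrightarrow>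
     (\<lambda>t. f (line_through u j t)) differentiable (at (u $ j) within {0..1})"

definition partial :: "(real ^ 'n::finite \<Rightarrow> real) \<Rightarrow> 'n \<Rightarrow> real ^ 'n \<Rightarrow> real" where
  "partial f j u = vector_derivative (\<lambda>t. f (line_through u j t)) (at (u $ j) within {0..1})"

definition G_matrix :: "('n::finite \<Rightarrow> 'n state \<Rightarrow> real) \<Rightarrow> real ^ 'n \<Rightarrow> real ^ 'n ^ 'n" where
  "G_matrix b u =
     (\<chi> i j. (if i = j then 1 else 0) - partial (gen_fun b i) j u / b i (unit_state i))"

text \<open>The operation \<open>^\<close> on \<^typ>\<open>real ^ 'n ^ 'n\<close> is entrywise, hence the explicit iteration.\<close>
definition matrix_power :: "real ^ 'n ^ 'n \<Rightarrow> nat \<Rightarrow> real ^ 'n::finite ^ 'n" where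
  "matrix_power A m = (((**) A) ^^ m) (mat 1)"

text \<open>
  The zeroth power is excluded; it would make every matrix of size one positively regular.
\<close>
definition positively_regular :: "real ^ 'n ^ 'n::finite \<Rightarrow> bool" where
  "positively_regular A \<longleftrightarrow> (\<exists>m>0. \<forall>i j. matrix_power A m $ i $ j > 0)"

definition nonsingular :: "('n::finite \<Rightarrow> 'n state \<Rightarrow> real) \<Rightarrow> bool" where
  "nonsingular b \<longleftrightarrow>
     \<not> (\<exists>M :: real ^ 'n ^ 'n. \<forall>u\<in>{0..1}. (\<chi> k. gen_fun b k u) = M *v u)"

definition is_smallest_root :: "('n::finite \<Rightarrow> 'n state \<Rightarrow> real) \<Rightarrow> real ^ 'n \<Rightarrow> bool" where
  "is_smallest_root b q \<longleftrightarrow>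
     q \<in> {0..1} \<and> (\<forall>k. gen_fun b k q = 0) \<and>
     (\<forall>u\<in>{0..1}. (\<forall>k. gen_fun b k u = 0) \<longrightarrow> q \<le> u)"

end

theory Submission
  imports Defs
begin

text \<open>
  Let \<open>B\<^sub>k(q) = 0\<close> for all \<open>k\<close> and \<open>A(u) = (\<Sum>\<^sub>j a\<^sub>j u\<^sup>j)\<close>. Because immigration is also allowed at \<open>0\<close>, the
  monomials satisfy \<open>(Q q\<^sup>\<bullet>)\<^sub>i = A(q) q\<^sup>i\<close>, so \<open>y\<close> is a \<open>\<mu>\<close>-invariant vector for \<open>Q\<close> with
  \<open>\<mu> = - A(q)\<close>. Weighting the jumps by \<open>y\<close> turns \<open>Q + \<mu>\<close> into a conservative matrix which, by
  (A-2), is again a branching matrix with finite mean family sizes plus immigration of finite total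
  rate; such a process does not explode, which gives \<open>\<mu>\<close>-invariance for \<open>P(t)\<close> and shows that bounded
  subsolutions of the weighted backward equation lie below \<open>P(t)\<close>.

  It remains to see that the decay parameter is \<open>\<mu>\<close>. Invariance yields \<open>p\<^sub>0\<^sub>0(t) \<le> exp (- \<mu> t)\<close>.
  Conversely, if \<open>u' \<le> B(u)\<close> and \<open>u(0) = 0\<close>, then \<open>exp (\<integral>\<^sub>0\<^sup>t A(u(s)) ds) u(t)\<^sup>i\<close> is a subsolution,
  hence at most \<open>p\<^sub>i\<^sub>0(t)\<close>; the Picard iterates \<open>u\<close> started at \<open>0\<close> have limits as \<open>t\<close> grows that
  increase to the smallest root \<open>q\<close>.
\<close>

section \<open>The backward integral equation\<close>

text \<open>Countability makes the counting measure sigma-finite, and on a product with a countable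
  discrete factor measurability of all sections is joint measurability. The usual theorem on
  integrals depending on a parameter then applies.\<close>

lemma borel_measurable_count_space_nn_integral:
  fixes f :: "'a \<Rightarrow> 's::countable \<Rightarrow> ennreal"
  assumes "\<And>k. (\<lambda>x. f x k) \<in> borel_measurable M"
  shows "(\<lambda>x. \<integral>\<^sup>+k. f x k \<partial>count_space A) \<in> borel_measurable M"
proof -
  interpret sigma_finite_measure "count_space A"
    by (rule sigma_finite_measure_count_space_countable) simp
  have "(\<lambda>z. f (snd z) (fst z)) \<in> borel_measurable (count_space A \<Otimes>\<^sub>M M)"
    by (rule measurable_pair_measure_countable1) (simp_all add: assms)
  then have "(\<lambda>z. (case z of (k, x) \<Rightarrow> f x k)) \<in> borel_measurable (count_space A \<Otimes>\<^sub>M M)"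
    by (simp add: case_prod_beta)
  then have "(\<lambda>z. f (fst z) (snd z)) \<in> borel_measurable (M \<Otimes>\<^sub>M count_space A)"
    using measurable_pair_swap_iff[of "\<lambda>z. f (fst z) (snd z)" M "count_space A" borel]
    by (simp add: case_prod_beta)
  then show ?thesis
    by (intro borel_measurable_nn_integral) (simp add: case_prod_beta)
qed

text \<open>The jump part of \<open>Q\<close> applied to \<open>f\<close>. Values in
  \<open>ennreal\<close> spare all questions of convergence and let Tonelli act freely.\<close>

definition offdiag_sum :: "('s \<Rightarrow> 's \<Rightarrow> real) \<Rightarrow> ('s \<Rightarrow> ennreal) \<Rightarrow> 's \<Rightarrow> ennreal" where
  "offdiag_sum Q f i = (\<integral>\<^sup>+k. ennreal (Q i k) * f k \<partial>count_space (UNIV - {i}))"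

text \<open>The integral operator of the backward equation. The target state of
  \<open>feller_iter\<close> is a mere parameter there, so the Feller iterates, the defects and the
  subsolutions are all handled as functions of time and starting state under this one
  operator.\<close>

definition backward_step ::
    "('s \<Rightarrow> 's \<Rightarrow> real) \<Rightarrow> (real \<Rightarrow> 's \<Rightarrow> ennreal) \<Rightarrow> real \<Rightarrow> 's \<Rightarrow> ennreal" where
  "backward_step Q g t i =
     (\<integral>\<^sup>+s\<in>{0..t}. ennreal (exp (Q i i * s)) * offdiag_sum Q (g (t - s)) i \<partial>lborel)"

lemma feller_iter_Suc:
  "feller_iter Q (Suc m) t i j =
     (if i = j then ennreal (exp (Q i i * t)) else 0)
     + backward_step Q (\<lambda>t k. feller_iter Q m t k j) t i"
  by (simp add: backward_step_def offdiag_sum_def)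

section \<open>Order, linearity and Tonelli for the backward operator\<close>

lemma offdiag_sum_mono:
  assumes "\<And>k. f k \<le> g k"
  shows "offdiag_sum Q f i \<le> offdiag_sum Q g i"
  unfolding offdiag_sum_def by (intro nn_integral_mono mult_left_mono assms) simp

lemma offdiag_sum_add:
  "offdiag_sum Q (\<lambda>k. f k + g k) i = offdiag_sum Q f i + offdiag_sum Q g i"
  unfolding offdiag_sum_def by (simp add: distrib_left nn_integral_add)

lemma offdiag_sum_cmult: "offdiag_sum Q (\<lambda>k. c * f k) i = c * offdiag_sum Q f i"
  unfolding offdiag_sum_def
  by (subst nn_integral_cmult[symmetric]) (simp_all add: mult.left_commute)

lemma offdiag_sum_swap:
  fixes f :: "'s::countable \<Rightarrow> 't::countable \<Rightarrow> ennreal"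
  shows "offdiag_sum Q (\<lambda>k. \<integral>\<^sup>+j. f k j \<partial>count_space A) i
       = (\<integral>\<^sup>+j. offdiag_sum Q (\<lambda>k. f k j) i \<partial>count_space A)"
proof -
  have "offdiag_sum Q (\<lambda>k. \<integral>\<^sup>+j. f k j \<partial>count_space A) i
      = (\<integral>\<^sup>+k. \<integral>\<^sup>+j. ennreal (Q i k) * f k j \<partial>count_space A \<partial>count_space (UNIV - {i}))"
    unfolding offdiag_sum_def
    by (intro nn_integral_cong, subst nn_integral_cmult) simp_all
  also have "\<dots> = (\<integral>\<^sup>+j. offdiag_sum Q (\<lambda>k. f k j) i \<partial>count_space A)"
    unfolding offdiag_sum_def by (rule nn_integral_count_space_nn_integral) simp_all
  finally show ?thesis .
qed

lemma measurable_offdiag_sum: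
  fixes g :: "real \<Rightarrow> 's::countable \<Rightarrow> ennreal"
  assumes "\<And>k. (\<lambda>t. g t k) \<in> borel_measurable borel"
  shows "(\<lambda>t. offdiag_sum Q (g t) i) \<in> borel_measurable borel"
  unfolding offdiag_sum_def
  by (intro borel_measurable_count_space_nn_integral borel_measurable_times_ennreal assms) simp

lemma measurable_backward_integrand:
  fixes g :: "real \<Rightarrow> 's::countable \<Rightarrow> ennreal"
  assumes "\<And>k. (\<lambda>t. g t k) \<in> borel_measurable borel"
  shows "(\<lambda>s. ennreal (exp (Q i i * s)) * offdiag_sum Q (g (t - s)) i) \<in> borel_measurable borel"
proof -
  have [measurable]: "(\<lambda>t. offdiag_sum Q (g t) i) \<in> borel_measurable borel"
    by (rule measurable_offdiag_sum) (rule assms)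
  show ?thesis by measurable
qed

lemma measurable_backward_step:
  fixes g :: "real \<Rightarrow> 's::countable \<Rightarrow> ennreal"
  assumes "\<And>k. (\<lambda>t. g t k) \<in> borel_measurable borel"
  shows "(\<lambda>t. backward_step Q g t i) \<in> borel_measurable borel"
proof -
  have [measurable]: "(\<lambda>t. offdiag_sum Q (g t) i) \<in> borel_measurable borel"
    by (rule measurable_offdiag_sum) (rule assms)
  \<comment> \<open>The domain of integration depends on \<open>t\<close>; its indicator is
    therefore treated as a function on the plane.\<close>
  have "(\<lambda>z. ennreal (exp (Q i i * snd z)) * offdiag_sum Q (g (fst z - snd z)) i
          * indicator {z. 0 \<le> snd z \<and> snd z \<le> fst z} z)
        \<in> borel_measurable (borel \<Otimes>\<^sub>M lborel)"
    by measurable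
  then have "(\<lambda>t. \<integral>\<^sup>+s. ennreal (exp (Q i i * s)) * offdiag_sum Q (g (t - s)) i
          * indicator {z. 0 \<le> snd z \<and> snd z \<le> fst z} (t, s) \<partial>lborel) \<in> borel_measurable borel"
    by (intro lborel.borel_measurable_nn_integral) (simp add: case_prod_beta)
  moreover have "indicator {z. 0 \<le> snd z \<and> snd z \<le> fst z} (t, s) = (indicator {0..t} s :: ennreal)"
    for t s :: real
    by (simp add: indicator_def)
  ultimately show ?thesis
    unfolding backward_step_def by simp
qed

lemma backward_step_mono:
  assumes "\<And>s k. 0 \<le> s \<Longrightarrow> s \<le> t \<Longrightarrow> f s k \<le> g s k"
  shows "backward_step Q f t i \<le> backward_step Q g t i"
  unfolding backward_step_def
  by (intro nn_integral_mono)
    (auto simp: indicator_def intro!: mult_left_mono offdiag_sum_mono assms)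

lemma backward_step_add:
  fixes f g :: "real \<Rightarrow> 's::countable \<Rightarrow> ennreal"
  assumes "\<And>k. (\<lambda>t. f t k) \<in> borel_measurable borel"
    and "\<And>k. (\<lambda>t. g t k) \<in> borel_measurable borel"
  shows "backward_step Q (\<lambda>t k. f t k + g t k) t i = backward_step Q f t i + backward_step Q g t i"
  unfolding backward_step_def offdiag_sum_add distrib_left distrib_right
  using measurable_backward_integrand[OF assms(1), of Q i t]
    measurable_backward_integrand[OF assms(2), of Q i t]
  by (intro nn_integral_add) auto

lemma backward_step_swap:
  fixes f :: "real \<Rightarrow> 's::countable \<Rightarrow> 't::countable \<Rightarrow> ennreal"
  assumes "\<And>k j. (\<lambda>t. f t k j) \<in> borel_measurable borel"
  shows "backward_step Q (\<lambda>t k. \<integral>\<^sup>+j. f t k j \<partial>count_space UNIV) t i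
       = (\<integral>\<^sup>+j. backward_step Q (\<lambda>t k. f t k j) t i \<partial>count_space UNIV)"
proof -
  have "(\<lambda>s. ennreal (exp (Q i i * s)) * offdiag_sum Q (\<lambda>k. f (t - s) k j) i * indicator {0..t} s)
      \<in> borel_measurable lborel" for j
    using measurable_backward_integrand[of "\<lambda>t k. f t k j" Q i t, OF assms] by auto
  then have "(\<integral>\<^sup>+j. backward_step Q (\<lambda>t k. f t k j) t i \<partial>count_space UNIV)
      = (\<integral>\<^sup>+s. \<integral>\<^sup>+j. ennreal (exp (Q i i * s)) * offdiag_sum Q (\<lambda>k. f (t - s) k j) i
          * indicator {0..t} s \<partial>count_space UNIV \<partial>lborel)"
    unfolding backward_step_def
    by (intro nn_integral_count_space_nn_integral[symmetric]) simp_all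
  also have "\<dots> = backward_step Q (\<lambda>t k. \<integral>\<^sup>+j. f t k j \<partial>count_space UNIV) t i"
    unfolding backward_step_def offdiag_sum_swap
    by (intro nn_integral_cong, subst nn_integral_multc, simp, subst nn_integral_cmult) simp_all
  finally show ?thesis by simp
qed

lemma backward_step_cmult:
  fixes f :: "real \<Rightarrow> 's::countable \<Rightarrow> ennreal"
  assumes "\<And>k. (\<lambda>t. f t k) \<in> borel_measurable borel"
  shows "backward_step Q (\<lambda>t k. f t k * c) t i = backward_step Q f t i * c"
proof -
  have *: "offdiag_sum Q (\<lambda>k. f s k * c) i = offdiag_sum Q (f s) i * c" for s
    using offdiag_sum_cmult[of Q c "f s" i] by (simp add: mult.commute)
  have [measurable]: "(\<lambda>t. offdiag_sum Q (f t) i) \<in> borel_measurable borel"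
    by (rule measurable_offdiag_sum) (rule assms)
  show ?thesis
    unfolding backward_step_def *
    by (subst nn_integral_multc[symmetric]) (measurable, simp add: mult_ac)
qed

text \<open>Variation of constants: \<open>- (exp (q * s) * v (t - s))\<close> is an antiderivative
  of the integrand, because the two terms containing \<open>q\<close> cancel. Nonnegativity of
  \<open>w\<close> turns the gauge integral into a nonnegative Lebesgue integral.\<close>

lemma backward_exact:
  fixes v w :: "real \<Rightarrow> real"
  assumes "0 \<le> t"
    and deriv: "\<And>s. 0 \<le> s \<Longrightarrow> s \<le> t \<Longrightarrow> (v has_real_derivative (q * v s + w s)) (at s within {0..t})"
    and w: "\<And>s. 0 \<le> s \<Longrightarrow> s \<le> t \<Longrightarrow> 0 \<le> w s"
  shows "exp (q * t) * v 0 \<le> v t"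
    and "(\<integral>\<^sup>+s\<in>{0..t}. ennreal (exp (q * s)) * ennreal (w (t - s)) \<partial>lborel)
       = ennreal (v t - exp (q * t) * v 0)"
proof -
  let ?F = "\<lambda>s. - (exp (q * s) * v (t - s))"
  define f where "f s = exp (q * s) * w (t - s)" for s
  have v: "((\<lambda>s. v (t - s)) has_real_derivative (q * v (t - s) + w (t - s)) * (- 1)) (at s within {0..t})"
    if "0 \<le> s" "s \<le> t" for s
  proof -
    have 1: "((\<lambda>s. t - s) has_real_derivative - 1) (at s within {0..t})"
      by (auto intro!: derivative_eq_intros)
    have "(\<lambda>s. t - s) ` {0..t} = {0..t}" by auto
    then have 2: "(v has_real_derivative q * v (t - s) + w (t - s)) (at (t - s) within (\<lambda>s. t - s) ` {0..t})"
      using deriv[of "t - s"] that by simp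
    from DERIV_image_chain[OF 2 1] show ?thesis unfolding o_def .
  qed
  have F: "(?F has_vector_derivative f s) (at s within {0..t})" if "0 \<le> s" "s \<le> t" for s
  proof -
    have "((\<lambda>s. exp (q * s)) has_real_derivative exp (q * s) * q) (at s within {0..t})"
      by (rule derivative_eq_intros refl)+ simp
    from DERIV_minus[OF DERIV_mult[OF this v[OF that]]]
    have "(?F has_real_derivative f s) (at s within {0..t})"
      by (rule back_subst) (use that in \<open>simp add: f_def algebra_simps\<close>)
    then show ?thesis
      by (simp only: has_real_derivative_iff_has_vector_derivative)
  qed
  have pos: "0 \<le> f s" if "0 \<le> s" "s \<le> t" for s
    using w[of "t - s"] that by (simp add: f_def)
  have I: "(f has_integral (?F t - ?F 0)) {0..t}"
    by (rule fundamental_theorem_of_calculus) (use F \<open>0 \<le> t\<close> in auto)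
  have *: "(\<integral>\<^sup>+s. ennreal (f s) * indicator {0..t} s \<partial>lborel) = ennreal (?F t - ?F 0)"
    by (rule nn_integral_has_integral_lebesgue'[OF _ I]) (simp add: pos)
  from has_integral_nonneg[OF I] pos have "?F 0 \<le> ?F t" by simp
  then show "exp (q * t) * v 0 \<le> v t" by simp
  have "(\<integral>\<^sup>+s\<in>{0..t}. ennreal (exp (q * s)) * ennreal (w (t - s)) \<partial>lborel)
      = (\<integral>\<^sup>+s. ennreal (f s) * indicator {0..t} s \<partial>lborel)"
    by (intro nn_integral_cong) (auto simp: f_def indicator_def w ennreal_mult)
  with * show "(\<integral>\<^sup>+s\<in>{0..t}. ennreal (exp (q * s)) * ennreal (w (t - s)) \<partial>lborel)
       = ennreal (v t - exp (q * t) * v 0)"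
    by simp
qed

lemma backward_step_cong:
  assumes "\<And>s k. 0 \<le> s \<Longrightarrow> s \<le> t \<Longrightarrow> f s k = g s k"
  shows "backward_step Q f t i = backward_step Q g t i"
  by (intro antisym backward_step_mono) (simp_all add: assms)

text \<open>Converts a pointwise bound on the jump part into a bound on the integral operator: if
  \<open>w\<close> dominates the jump part of \<open>g\<close>, the explicit solution
  \<open>v\<close> of the linear equation with source \<open>w\<close> dominates.\<close>

lemma backward_step_le:
  fixes v w :: "real \<Rightarrow> real"
  assumes "0 \<le> t"
    and "\<And>s. 0 \<le> s \<Longrightarrow> s \<le> t \<Longrightarrow> (v has_real_derivative (Q i i * v s + w s)) (at s within {0..t})"
    and "\<And>s. 0 \<le> s \<Longrightarrow> s \<le> t \<Longrightarrow> 0 \<le> w s"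
    and "\<And>s. 0 \<le> s \<Longrightarrow> s \<le> t \<Longrightarrow> offdiag_sum Q (g s) i \<le> ennreal (w s)"
  shows "backward_step Q g t i \<le> ennreal (v t - exp (Q i i * t) * v 0)"
proof -
  have "backward_step Q g t i
      \<le> (\<integral>\<^sup>+s\<in>{0..t}. ennreal (exp (Q i i * s)) * ennreal (w (t - s)) \<partial>lborel)"
    unfolding backward_step_def
    by (intro nn_integral_mono) (auto simp: indicator_def intro!: mult_left_mono assms(4))
  also have "\<dots> = ennreal (v t - exp (Q i i * t) * v 0)"
    by (rule backward_exact(2)) (fact assms(1-3))+
  finally show ?thesis .
qed

text \<open>The opposite comparison. With \<open>g\<close> built from \<open>v\<close> itself it
  shows that a differential inequality makes \<open>v\<close> a subsolution of the integral
  equation.\<close>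

lemma backward_step_ge:
  fixes v w :: "real \<Rightarrow> real"
  assumes "0 \<le> t"
    and "\<And>s. 0 \<le> s \<Longrightarrow> s \<le> t \<Longrightarrow> (v has_real_derivative (Q i i * v s + w s)) (at s within {0..t})"
    and "\<And>s. 0 \<le> s \<Longrightarrow> s \<le> t \<Longrightarrow> 0 \<le> w s"
    and "\<And>s. 0 \<le> s \<Longrightarrow> s \<le> t \<Longrightarrow> ennreal (w s) \<le> offdiag_sum Q (g s) i"
  shows "ennreal (v t) \<le> ennreal (exp (Q i i * t) * v 0) + backward_step Q g t i"
proof -
  have "ennreal (v t - exp (Q i i * t) * v 0)
      = (\<integral>\<^sup>+s\<in>{0..t}. ennreal (exp (Q i i * s)) * ennreal (w (t - s)) \<partial>lborel)"
    by (rule backward_exact(2)[symmetric]) (fact assms(1-3))+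
  also have "\<dots> \<le> backward_step Q g t i"
    unfolding backward_step_def
    by (intro nn_integral_mono) (auto simp: indicator_def intro!: mult_left_mono assms(4))
  finally have "ennreal (v t - exp (Q i i * t) * v 0) \<le> backward_step Q g t i" .
  moreover have "exp (Q i i * t) * v 0 \<le> v t"
    by (rule backward_exact(1)) (fact assms(1-3))+
  \<comment> \<open>No sign of \<open>v 0\<close> is assumed; if it is negative, truncation by
    \<open>ennreal\<close> only enlarges the right-hand side.\<close>
  then have "ennreal (v t) \<le> ennreal (exp (Q i i * t) * v 0) + ennreal (v t - exp (Q i i * t) * v 0)"
    using ennreal_plus_if[of "exp (Q i i * t) * v 0" "v t - exp (Q i i * t) * v 0"]
    by (auto simp: ennreal_neg intro: ennreal_leI)
  ultimately show ?thesis by (meson add_left_mono order_trans)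
qed

section \<open>Measurability and monotonicity of the Feller iterates\<close>

lemma measurable_feller_iter:
  fixes Q :: "'s::countable \<Rightarrow> 's \<Rightarrow> real"
  shows "(\<lambda>t. feller_iter Q m t i j) \<in> borel_measurable borel"
proof (induction m arbitrary: i)
  case (Suc m)
  show ?case
    unfolding feller_iter_Suc
    by (intro borel_measurable_add measurable_backward_step Suc) simp
qed simp

lemma feller_iter_mono: "feller_iter Q m t i j \<le> feller_iter Q (Suc m) t i j"
proof (induction m arbitrary: t i)
  case (Suc m)
  show ?case
    unfolding feller_iter_Suc by (intro add_left_mono backward_step_mono Suc[unfolded feller_iter_Suc])
qed simp

section \<open>Defect and explosion\<close>

text \<open>The defect is the part of the mass \<open>exp (- \<mu> t) y\<^sub>i\<close> carried by the paths with at least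
  \<open>m\<close> jumps; explosion means that it does not vanish as \<open>m\<close> grows.\<close>

locale weighted_q_matrix =
  fixes Q :: "'s::countable \<Rightarrow> 's \<Rightarrow> real" and y :: "'s \<Rightarrow> real" and \<mu> :: real
  assumes y_nonneg: "0 \<le> y j"
    and rate_nonneg: "0 \<le> - \<mu> - Q i i"
    and offdiag_sum_y: "offdiag_sum Q (\<lambda>k. ennreal (y k)) i = ennreal ((- \<mu> - Q i i) * y i)"
begin

primrec defect :: "nat \<Rightarrow> real \<Rightarrow> 's \<Rightarrow> ennreal" where
  "defect 0 = (\<lambda>t i. ennreal (exp (- \<mu> * t) * y i))"
| "defect (Suc m) = (\<lambda>t i. backward_step Q (defect m) t i)"

lemma measurable_defect: "(\<lambda>t. defect m t i) \<in> borel_measurable borel"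
  by (induction m arbitrary: i) (simp_all add: measurable_backward_step)

text \<open>\<open>offdiag_sum_y\<close> is the off-diagonal half of the equation
  \<open>Q y = - \<mu> y\<close>. Hence \<open>exp (- \<mu> * t) * y i\<close> solves the linear
  equation whose source is its own jump part, and both comparisons hold with the same
  \<open>v\<close> and \<open>w\<close>.\<close>

lemma exponential_backward:
  assumes "0 \<le> t"
  shows "ennreal (exp (Q i i * t) * y i) + backward_step Q (\<lambda>t k. ennreal (exp (- \<mu> * t) * y k)) t i
       = ennreal (exp (- \<mu> * t) * y i)"
proof -
  let ?v = "\<lambda>s. exp (- \<mu> * s) * y i" and ?w = "\<lambda>s. exp (- \<mu> * s) * ((- \<mu> - Q i i) * y i)"
  have d: "(?v has_real_derivative (Q i i * ?v s + ?w s)) (at s within {0..t})" for s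
    by (rule derivative_eq_intros refl)+ (simp add: algebra_simps)
  have w: "0 \<le> ?w s" for s
    using rate_nonneg y_nonneg by simp
  have s: "offdiag_sum Q (\<lambda>k. ennreal (exp (- \<mu> * s) * y k)) i = ennreal (?w s)" for s
    by (simp add: ennreal_mult' offdiag_sum_cmult offdiag_sum_y)
  have "backward_step Q (\<lambda>t k. ennreal (exp (- \<mu> * t) * y k)) t i
      \<le> ennreal (?v t - exp (Q i i * t) * ?v 0)"
    by (rule backward_step_le[where v = ?v and w = ?w and Q = Q and i = i, OF assms d w]) (simp only: s order_refl)
  moreover have "exp (Q i i * t) * ?v 0 \<le> ?v t"
    by (rule backward_exact(1)[where v = ?v and w = ?w and q = "Q i i", OF assms d w])
  then have "ennreal (?v t) = ennreal (exp (Q i i * t) * ?v 0) + ennreal (?v t - exp (Q i i * t) * ?v 0)"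
    by (subst ennreal_plus[symmetric]) (simp_all add: y_nonneg)
  moreover have "ennreal (?v t) \<le> ennreal (exp (Q i i * t) * ?v 0)
      + backward_step Q (\<lambda>t k. ennreal (exp (- \<mu> * t) * y k)) t i"
    by (rule backward_step_ge[where v = ?v and w = ?w and Q = Q and i = i, OF assms d w]) (simp only: s order_refl)
  ultimately show ?thesis
    by (intro antisym) (simp_all add: add_left_mono)
qed

text \<open>Conservation of mass. At \<open>m = 0\<close> all of it is defect; afterwards both
  summands follow the same backward recursion, only the first with the term for no jump, and their
  total is reproduced by \<open>exponential_backward\<close>.\<close>

lemma feller_iter_plus_defect:
  assumes "0 \<le> t"
  shows "(\<integral>\<^sup>+j. feller_iter Q m t i j * ennreal (y j) \<partial>count_space UNIV) + defect m t i
       = ennreal (exp (- \<mu> * t) * y i)"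
  using assms
proof (induction m arbitrary: t i)
  case (Suc m)
  let ?S = "\<lambda>m t i. \<integral>\<^sup>+j. feller_iter Q m t i j * ennreal (y j) \<partial>count_space UNIV"
  have m: "(\<lambda>t. ?S m t i) \<in> borel_measurable borel" for i
    by (intro borel_measurable_count_space_nn_integral borel_measurable_times_ennreal
        measurable_feller_iter) simp
  have "?S (Suc m) t i
      = (\<integral>\<^sup>+j. (ennreal (exp (Q i i * t) * y i) * indicator {i} j
          + backward_step Q (\<lambda>t k. feller_iter Q m t k j * ennreal (y j)) t i) \<partial>count_space UNIV)"
    unfolding feller_iter_Suc
    by (intro nn_integral_cong)
      (auto simp: distrib_right backward_step_cmult measurable_feller_iter ennreal_mult' indicator_def)
  also have "\<dots> = ennreal (exp (Q i i * t) * y i) + backward_step Q (?S m) t i"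
    by (subst nn_integral_add)
      (simp_all add: backward_step_swap measurable_feller_iter borel_measurable_times_ennreal
        nn_integral_cmult)
  finally have "?S (Suc m) t i + defect (Suc m) t i
      = ennreal (exp (Q i i * t) * y i) + (backward_step Q (?S m) t i + backward_step Q (defect m) t i)"
    by (simp add: add.assoc)
  also have "backward_step Q (?S m) t i + backward_step Q (defect m) t i
      = backward_step Q (\<lambda>t i. ?S m t i + defect m t i) t i"
    by (rule backward_step_add[symmetric]) (rule m measurable_defect)+
  also have "\<dots> = backward_step Q (\<lambda>t k. ennreal (exp (- \<mu> * t) * y k)) t i"
    by (rule backward_step_cong) (rule Suc.IH)
  finally show ?case
    using exponential_backward[OF Suc.prems] by simp
qed simp

lemma feller_iter_le:
  assumes "0 \<le> t"
  shows "feller_iter Q m t i j * ennreal (y j) \<le> ennreal (exp (- \<mu> * t) * y i)"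
proof -
  have "feller_iter Q m t i j * ennreal (y j)
      \<le> (\<integral>\<^sup>+j. feller_iter Q m t i j * ennreal (y j) \<partial>count_space UNIV)"
    by (rule nn_integral_ge_point) simp
  also have "\<dots> \<le> ennreal (exp (- \<mu> * t) * y i)"
    unfolding feller_iter_plus_defect[OF assms, symmetric, where m = m] by simp
  finally show ?thesis .
qed

text \<open>Unfolding the subsolution inequality \<open>m\<close> times gives the Feller recursion,
  with a remainder started from the majorant of \<open>h\<close>; that remainder is the
  defect.\<close>

lemma subsolution_le:
  fixes h :: "real \<Rightarrow> 's \<Rightarrow> real"
  assumes "\<And>s k. 0 \<le> s \<Longrightarrow> h s k \<le> exp (- \<mu> * s) * y k"
    and sub: "\<And>s k. 0 \<le> s \<Longrightarrow> ennreal (h s k) \<le> (if k = j then ennreal (exp (Q k k * s)) else 0)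
            + backward_step Q (\<lambda>s k. ennreal (h s k)) s k"
    and "0 \<le> t"
  shows "ennreal (h t i) \<le> feller_iter Q m t i j + defect m t i"
  using assms(3)
proof (induction m arbitrary: t i)
  case 0
  then show ?case using assms(1)[of t i] by (simp add: ennreal_leI)
next
  case (Suc m)
  have "ennreal (h t i) \<le> (if i = j then ennreal (exp (Q i i * t)) else 0)
      + backward_step Q (\<lambda>s k. ennreal (h s k)) t i"
    by (rule sub) (rule Suc.prems)
  also have "\<dots> \<le> (if i = j then ennreal (exp (Q i i * t)) else 0)
      + backward_step Q (\<lambda>s k. feller_iter Q m s k j + defect m s k) t i"
    by (intro add_left_mono backward_step_mono Suc.IH)
  also have "\<dots> = feller_iter Q (Suc m) t i j + defect (Suc m) t i"
    unfolding feller_iter_Suc defect.simps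
    by (subst backward_step_add) (auto intro: measurable_feller_iter measurable_defect simp: add.assoc)
  finally show ?case .
qed

text \<open>Non-explosion by a Lyapunov function \<open>V\<close>. After weighting by
  \<open>y\<close>, the exit rate at \<open>i\<close> is at most \<open>K * V i\<close>, the jumps
  in \<open>Q1\<close> enlarge \<open>V\<close> in the mean in a way controlled by \<open>C\<close>,
  and the jumps in \<open>Q2\<close> have total rate at most \<delta>. The term
  \<open>\<delta> * t\<close> pays for the \<open>Q2\<close> jumps; the term with
  \<open>V i / (m + 1)\<close> reflects that many jumps in a short time need large
  \<open>V\<close>.\<close>

lemma defect_le:
  assumes V: "\<And>i. 1 \<le> V i" "\<And>i. - \<mu> - Q i i \<le> K * V i"
    and "0 \<le> K" "0 \<le> C" "0 \<le> \<delta>"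
    and Q12: "\<And>i k. i \<noteq> k \<Longrightarrow> Q i k = Q1 i k + Q2 i k" "\<And>i k. i \<noteq> k \<Longrightarrow> 0 \<le> Q1 i k" "\<And>i k. i \<noteq> k \<Longrightarrow> 0 \<le> Q2 i k"
    and Q1: "\<And>i. offdiag_sum Q1 (\<lambda>k. ennreal (y k * V k)) i \<le> ennreal ((- \<mu> - Q i i + C) * (y i * V i))"
    and Q2: "\<And>i. offdiag_sum Q2 (\<lambda>k. ennreal (y k)) i \<le> ennreal (\<delta> * y i)"
    and "0 \<le> t"
  shows "defect m t i
    \<le> ennreal (exp (- \<mu> * t) * y i * (\<delta> * t + exp (2 * (K + C) * t) * V i / (m + 1)))"
  using \<open>0 \<le> t\<close>
proof (induction m arbitrary: t i)
  case 0
  have "1 \<le> \<delta> * t + exp (2 * (K + C) * t) * V i"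
    using mult_mono[of 1 "exp (2 * (K + C) * t)" 1 "V i"] V(1)[of i] 0 \<open>0 \<le> K\<close> \<open>0 \<le> C\<close>
      mult_nonneg_nonneg[OF \<open>0 \<le> \<delta>\<close> 0]
    by simp
  then have "exp (- \<mu> * t) * y i * 1 \<le> exp (- \<mu> * t) * y i * (\<delta> * t + exp (2 * (K + C) * t) * V i)"
    by (intro mult_left_mono) (simp_all add: y_nonneg)
  then show ?case by (simp add: ennreal_leI)
next
  case (Suc m)
  define c where "c = 2 * (K + C)"
  have c: "0 \<le> c" using assms by (simp add: c_def)
  have trivial_bound: "defect m t i \<le> ennreal (exp (- \<mu> * t) * y i)" if "0 \<le> t" for m t i
    unfolding feller_iter_plus_defect[OF that, symmetric, where m = m] by simp
  \<comment> \<open>If \<open>V i\<close> is at least \<open>m + 2\<close>, the claim is weaker than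
    conservation of mass. Otherwise the exit rate at \<open>i\<close> is at most
    \<open>K * (m + 2)\<close>, which makes the comparison argument work.\<close>
  show ?case
  proof (cases "V i \<ge> real m + 2")
    case True
    then have "1 \<le> V i / (m + 2)" by simp
    then have "1 \<le> \<delta> * t + exp (c * t) * (V i / (m + 2))"
      using mult_mono[of 1 "exp (c * t)" 1 "V i / (m + 2)"] Suc.prems c \<open>0 \<le> \<delta>\<close>
      by (simp add: add_increasing)
    then have "exp (- \<mu> * t) * y i * 1 \<le> exp (- \<mu> * t) * y i * (\<delta> * t + exp (c * t) * (V i / (m + 2)))"
      by (intro mult_left_mono) (simp_all add: y_nonneg)
    with trivial_bound[OF Suc.prems, of "Suc m" i] show ?thesis
      unfolding c_def[symmetric]
      by (auto simp: add.commute elim!: order_trans intro!: ennreal_leI)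
  next
    case False
    define R where "R = - \<mu> - Q i i"
    have R: "0 \<le> R" using rate_nonneg[of i] by (simp add: R_def)
    define D where "D = V i / (real m + 2)"
    \<comment> \<open>\<open>?v\<close> is the bound to be proved, and \<open>?w\<close> is the
      source that makes it an exact solution of the linear equation with coefficient
      \<open>Q i i\<close>.\<close>
    let ?v = "\<lambda>s. exp (- \<mu> * s) * y i * (\<delta> * s + exp (c * s) * D)"
    let ?w = "\<lambda>s. exp (- \<mu> * s) * y i * (\<delta> + \<delta> * s * R + exp (c * s) * D * (c + R))"
    have d: "(?v has_real_derivative (Q i i * ?v s + ?w s)) (at s within {0..t})" for s
      by (rule derivative_eq_intros refl)+ (simp add: R_def algebra_simps)
    have Vi: "0 \<le> V i" and D: "0 \<le> D" using V(1)[of i] by (simp_all add: D_def)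
    have w: "0 \<le> ?w s" if "0 \<le> s" for s
      using that R c D \<open>0 \<le> \<delta>\<close> by (intro mult_nonneg_nonneg add_nonneg_nonneg) (simp_all add: y_nonneg)
    \<comment> \<open>The price of passing from \<open>1 / (m + 1)\<close> to
      \<open>1 / (m + 2)\<close>. The factor 2 in \<open>c\<close> enters through
      \<open>m + 2 \<le> 2 * (m + 1)\<close>.\<close>
    have key: "(R + C) / (real m + 1) \<le> (c + R) / (real m + 2)"
    proof -
      have "R \<le> K * V i" using V(2) by (simp add: R_def)
      also have "\<dots> \<le> K * (real m + 2)" using False \<open>0 \<le> K\<close> by (intro mult_left_mono) auto
      finally have "(R + C) * (real m + 2) \<le> (c + R) * (real m + 1)"
        using mult_nonneg_nonneg[OF \<open>0 \<le> C\<close>, of m] mult_nonneg_nonneg[OF \<open>0 \<le> K\<close>, of m] by (simp add: c_def algebra_simps)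
      then show ?thesis by (simp add: field_simps)
    qed
    have s: "offdiag_sum Q (defect m s) i \<le> ennreal (?w s)" if "0 \<le> s" for s
    proof -
      let ?A = "exp (- \<mu> * s) * (\<delta> * s)" and ?B = "exp (- \<mu> * s) * (exp (c * s) / (real m + 1))"
      have "offdiag_sum Q (defect m s) i = offdiag_sum Q1 (defect m s) i + offdiag_sum Q2 (defect m s) i"
        unfolding offdiag_sum_def
        by (subst nn_integral_add[symmetric])
          (auto intro!: nn_integral_cong simp: Q12 distrib_right)
      \<comment> \<open>The induction hypothesis is used after a \<open>Q1\<close> jump only. After
        a \<open>Q2\<close> jump, where nothing is known about \<open>V\<close>, the trivial bound
        by the total mass must do.\<close>
      also have "\<dots> \<le> offdiag_sum Q1 (\<lambda>k. ennreal ?A * ennreal (y k) + ennreal ?B * ennreal (y k * V k)) i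
          + offdiag_sum Q2 (\<lambda>k. ennreal (exp (- \<mu> * s)) * ennreal (y k)) i"
      proof (intro add_mono offdiag_sum_mono)
        fix k
        have Vk: "0 \<le> V k" using V(1)[of k] by simp
        show "defect m s k \<le> ennreal ?A * ennreal (y k) + ennreal ?B * ennreal (y k * V k)"
          using Suc.IH[OF that, of k, folded c_def] that Vk \<open>0 \<le> \<delta>\<close> y_nonneg[of k]
          by (simp add: ennreal_mult[symmetric] ennreal_plus[symmetric] algebra_simps
              del: ennreal_plus)
        show "defect m s k \<le> ennreal (exp (- \<mu> * s)) * ennreal (y k)"
          using trivial_bound[OF that, of m k] by (simp add: ennreal_mult')
      qed
      also have "\<dots> = ennreal ?A * offdiag_sum Q1 (\<lambda>k. ennreal (y k)) i
          + ennreal ?B * offdiag_sum Q1 (\<lambda>k. ennreal (y k * V k)) i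
          + ennreal (exp (- \<mu> * s)) * offdiag_sum Q2 (\<lambda>k. ennreal (y k)) i"
        by (simp add: offdiag_sum_add offdiag_sum_cmult)
      also have "\<dots> \<le> ennreal ?A * ennreal (R * y i)
          + ennreal ?B * ennreal ((R + C) * (y i * V i))
          + ennreal (exp (- \<mu> * s)) * ennreal (\<delta> * y i)"
      proof (intro add_mono mult_left_mono Q2 zero_le)
        have "offdiag_sum Q1 (\<lambda>k. ennreal (y k)) i \<le> offdiag_sum Q (\<lambda>k. ennreal (y k)) i"
          unfolding offdiag_sum_def
          by (intro nn_integral_mono mult_right_mono ennreal_leI) (auto simp: Q12)
        then show "offdiag_sum Q1 (\<lambda>k. ennreal (y k)) i \<le> ennreal (R * y i)"
          by (simp add: offdiag_sum_y R_def)
        show "offdiag_sum Q1 (\<lambda>k. ennreal (y k * V k)) i \<le> ennreal ((R + C) * (y i * V i))"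
          using Q1[of i] by (simp add: R_def)
      qed
      also have "\<dots> = ennreal (?A * (R * y i) + ?B * ((R + C) * (y i * V i)) + exp (- \<mu> * s) * (\<delta> * y i))"
        using that R Vi y_nonneg[of i] \<open>0 \<le> \<delta>\<close> \<open>0 \<le> C\<close>
        by (simp add: ennreal_mult[symmetric] ennreal_plus[symmetric] del: ennreal_plus)
      also have "\<dots> \<le> ennreal (?w s)"
      proof (rule ennreal_leI)
        have "exp (- \<mu> * s) * y i * exp (c * s) * V i * ((R + C) / (real m + 1))
            \<le> exp (- \<mu> * s) * y i * exp (c * s) * V i * ((c + R) / (real m + 2))"
          by (intro mult_left_mono key) (simp add: y_nonneg Vi)
        then show "?A * (R * y i) + ?B * ((R + C) * (y i * V i)) + exp (- \<mu> * s) * (\<delta> * y i) \<le> ?w s"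
          by (simp add: D_def algebra_simps)
      qed
      finally show ?thesis .
    qed
    have "defect (Suc m) t i \<le> ennreal (?v t - exp (Q i i * t) * ?v 0)"
      unfolding defect.simps using Suc.prems by (intro backward_step_le[where w = ?w] d w s)
    also have "\<dots> \<le> ennreal (?v t)"
      by (intro ennreal_leI) (simp add: y_nonneg D)
    finally show ?thesis by (simp add: c_def D_def add.commute)
  qed
qed

text \<open>The order of the choices matters: \<delta> determines the splitting and thereby
  \<open>C\<close>, and only then does \<open>m\<close> grow. So \<open>C\<close> may be unbounded
  as \<delta> tends to 0, whereas \<open>V\<close> and \<open>K\<close> are fixed
  beforehand.\<close>

lemma defect_tendsto_0:
  assumes V: "\<And>i. 1 \<le> V i" "\<And>i. - \<mu> - Q i i \<le> K * V i" and "0 \<le> K"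
    and split: "\<And>\<delta>. 0 < \<delta> \<Longrightarrow> \<exists>C\<ge>0. \<exists>Q1 Q2.
      (\<forall>i k. i \<noteq> k \<longrightarrow> Q i k = Q1 i k + Q2 i k \<and> 0 \<le> Q1 i k \<and> 0 \<le> Q2 i k) \<and>
      (\<forall>i. offdiag_sum Q1 (\<lambda>k. ennreal (y k * V k)) i \<le> ennreal ((- \<mu> - Q i i + C) * (y i * V i))) \<and>
      (\<forall>i. offdiag_sum Q2 (\<lambda>k. ennreal (y k)) i \<le> ennreal (\<delta> * y i))"
    and "0 \<le> t"
  shows "(\<lambda>m. defect m t i) \<longlonglongrightarrow> 0"
proof -
  define A where "A = exp (- \<mu> * t) * y i"
  have A: "0 \<le> A" by (simp add: A_def y_nonneg)
  have "defect m t i \<le> ennreal A" for m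
    unfolding A_def feller_iter_plus_defect[OF \<open>0 \<le> t\<close>, symmetric, where m = m] by simp
  then have d: "defect m t i = ennreal (enn2real (defect m t i))" for m
    by (metis ennreal_enn2real ennreal_less_top le_less_trans)
  have "(\<lambda>m. enn2real (defect m t i)) \<longlonglongrightarrow> 0"
  proof (rule LIMSEQ_I)
    fix \<epsilon> :: real assume "0 < \<epsilon>"
    \<comment> \<open>Makes the contribution of the \<open>Q2\<close> jumps less than half of
      \<epsilon>; the summand 1 keeps the denominator positive.\<close>
    define \<delta> where "\<delta> = \<epsilon> / (2 * (A * t + 1))"
    have At: "0 \<le> A * t" using A \<open>0 \<le> t\<close> by simp
    then have "0 < \<delta>" using \<open>0 < \<epsilon>\<close> by (simp add: \<delta>_def)
    have "A * t / (A * t + 1) < 1" using At by (simp add: field_simps)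
    then have "\<epsilon> / 2 * (A * t / (A * t + 1)) < \<epsilon> / 2 * 1"
      using \<open>0 < \<epsilon>\<close> by (intro mult_strict_left_mono) auto
    then have \<delta>: "A * (\<delta> * t) < \<epsilon> / 2" by (simp add: \<delta>_def mult_ac)
    from split[OF \<open>0 < \<delta>\<close>] obtain C Q1 Q2 where C: "0 \<le> C"
      and Q12: "\<forall>i k. i \<noteq> k \<longrightarrow> Q i k = Q1 i k + Q2 i k \<and> 0 \<le> Q1 i k \<and> 0 \<le> Q2 i k"
      and Q1: "\<forall>i. offdiag_sum Q1 (\<lambda>k. ennreal (y k * V k)) i \<le> ennreal ((- \<mu> - Q i i + C) * (y i * V i))"
      and Q2: "\<forall>i. offdiag_sum Q2 (\<lambda>k. ennreal (y k)) i \<le> ennreal (\<delta> * y i)"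
      by (elim exE conjE)
    define B where "B = A * (exp (2 * (K + C) * t) * V i)"
    have B: "0 \<le> B" using A V(1)[of i] by (simp add: B_def)
    have bound: "enn2real (defect m t i) \<le> A * (\<delta> * t) + B / (real m + 1)" for m
    proof -
      have "defect m t i \<le> ennreal (A * (\<delta> * t) + B / (real m + 1))"
        using defect_le[OF V \<open>0 \<le> K\<close> C less_imp_le[OF \<open>0 < \<delta>\<close>] _ _ _ _ _ \<open>0 \<le> t\<close>, of Q1 Q2 m i] Q12 Q1 Q2
        by (simp add: A_def B_def algebra_simps)
      moreover have "0 \<le> A * (\<delta> * t) + B / (real m + 1)"
        using A B \<open>0 < \<delta>\<close> \<open>0 \<le> t\<close> by simp
      ultimately show ?thesis by (metis enn2real_leI)
    qed
    obtain N :: nat where N: "B / (\<epsilon> / 2) < N" using reals_Archimedean2 by blast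
    show "\<exists>N. \<forall>m\<ge>N. norm (enn2real (defect m t i) - 0) < \<epsilon>"
    proof (intro exI allI impI)
      fix m assume "N \<le> m"
      with N have "B / (\<epsilon> / 2) < real m + 1" by linarith
      then have "B / (real m + 1) < \<epsilon> / 2"
        using \<open>0 < \<epsilon>\<close> by (simp add: field_simps)
      from le_less_trans[OF bound add_strict_mono[OF \<delta> this]]
      show "norm (enn2real (defect m t i) - 0) < \<epsilon>" by simp
    qed
  qed
  then have "(\<lambda>m. ennreal (enn2real (defect m t i))) \<longlonglongrightarrow> ennreal 0"
    by (rule tendsto_ennrealI)
  then show ?thesis unfolding d[symmetric] by simp
qed

text \<open>Monotone convergence in the conservation of mass: once the defect vanishes, the limit
  carries everything.\<close>

lemma nn_integral_feller_limit:
  assumes "0 \<le> t" and "(\<lambda>m. defect m t i) \<longlonglongrightarrow> 0"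
  shows "(\<integral>\<^sup>+j. (SUP m. feller_iter Q m t i j) * ennreal (y j) \<partial>count_space UNIV)
       = ennreal (exp (- \<mu> * t) * y i)"
proof -
  let ?S = "\<lambda>m. \<integral>\<^sup>+j. feller_iter Q m t i j * ennreal (y j) \<partial>count_space UNIV"
  have inc: "incseq (\<lambda>m j. feller_iter Q m t i j * ennreal (y j))"
    by (intro incseq_SucI) (auto simp: le_fun_def simp del: feller_iter.simps
        intro!: mult_right_mono feller_iter_mono)
  have "(\<integral>\<^sup>+j. (SUP m. feller_iter Q m t i j) * ennreal (y j) \<partial>count_space UNIV) = (SUP m. ?S m)"
    by (subst nn_integral_monotone_convergence_SUP[OF inc, symmetric])
      (simp_all add: SUP_mult_right_ennreal)
  moreover have "?S \<longlonglongrightarrow> (SUP m. ?S m)"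
    by (intro LIMSEQ_SUP incseq_SucI nn_integral_mono mult_right_mono feller_iter_mono) simp
  then have "(\<lambda>m. ?S m + defect m t i) \<longlonglongrightarrow> (SUP m. ?S m) + 0"
    by (intro tendsto_add assms(2))
  then have "(SUP m. ?S m) = ennreal (exp (- \<mu> * t) * y i)"
    unfolding feller_iter_plus_defect[OF assms(1)] by (simp add: LIMSEQ_const_iff)
  ultimately show ?thesis by simp
qed

text \<open>Minimality bounds Feller's solution from above by other nonnegative solutions. A
  vanishing defect gives comparison in the other direction, which is what a lower bound on
  transition probabilities requires.\<close>

lemma subsolution_le_feller_limit:
  fixes h :: "real \<Rightarrow> 's \<Rightarrow> real"
  assumes "\<And>s k. 0 \<le> s \<Longrightarrow> h s k \<le> exp (- \<mu> * s) * y k"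
    and "\<And>s k. 0 \<le> s \<Longrightarrow> ennreal (h s k) \<le> (if k = j then ennreal (exp (Q k k * s)) else 0)
            + backward_step Q (\<lambda>s k. ennreal (h s k)) s k"
    and "0 \<le> t" and lim: "(\<lambda>m. defect m t i) \<longlonglongrightarrow> 0"
  shows "ennreal (h t i) \<le> (SUP m. feller_iter Q m t i j)"
proof (rule LIMSEQ_le_const)
  show "(\<lambda>m. (SUP m. feller_iter Q m t i j) + defect m t i) \<longlonglongrightarrow> (SUP m. feller_iter Q m t i j)"
    using tendsto_add[OF tendsto_const lim, of "SUP m. feller_iter Q m t i j"] by simp
  have "ennreal (h t i) \<le> (SUP m. feller_iter Q m t i j) + defect m t i" for m
  proof -
    have "ennreal (h t i) \<le> feller_iter Q m t i j + defect m t i"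
      using assms(1-3) by (rule subsolution_le)
    also have "\<dots> \<le> (SUP m. feller_iter Q m t i j) + defect m t i"
      by (intro add_right_mono SUP_upper UNIV_I)
    finally show ?thesis .
  qed
  then show "\<exists>N. \<forall>m\<ge>N. ennreal (h t i) \<le> (SUP m. feller_iter Q m t i j) + defect m t i"
    by blast
qed

end

section \<open>Sums over the jumps of the branching process\<close>

text \<open>Passage from \<open>has_sum\<close>, in which rates and invariance are stated, to
  integrals over counting measure, in which the estimates are made. The next lemma is the way
  back.\<close>

lemma nn_integral_eq_ennreal_infsum:
  fixes f :: "'a \<Rightarrow> real"
  assumes "(f has_sum s) A" and "\<And>x. x \<in> A \<Longrightarrow> 0 \<le> f x"
  shows "(\<integral>\<^sup>+x. ennreal (f x) \<partial>count_space A) = ennreal s"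
proof -
  have "f summable_on A" using assms(1) has_sum_imp_summable by blast
  then have "Infinite_Sum.abs_summable_on f A"
    using summable_on_iff_abs_summable_on_real by blast
  then have *: "Infinite_Set_Sum.abs_summable_on f A"
    using abs_summable_equivalent[of f A] by blast
  then have "infsetsum f A = s"
    using infsetsum_infsum[OF *] infsumI[OF assms(1)] by simp
  then show ?thesis
    using nn_integral_conv_infsetsum[OF * assms(2)] by simp
qed

lemma has_sum_if_nn_integral:
  fixes f :: "'a \<Rightarrow> real"
  assumes "(\<integral>\<^sup>+x. ennreal (f x) \<partial>count_space A) = ennreal s"
    and "\<And>x. x \<in> A \<Longrightarrow> 0 \<le> f x" and "0 \<le> s"
  shows "(f has_sum s) A"
proof -
  have "integrable (count_space A) f"
    using assms by (intro integrableI_nonneg) (auto simp: AE_count_space)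
  then have *: "Infinite_Set_Sum.abs_summable_on f A"
    by (simp add: Infinite_Set_Sum.abs_summable_on_def)
  then have "f summable_on A"
    using abs_summable_equivalent[of f A] summable_on_iff_abs_summable_on_real by blast
  then have "(f has_sum infsum f A) A" by simp
  with nn_integral_eq_ennreal_infsum[OF this assms(2)] assms show ?thesis
    by (simp add: infsum_nonneg)
qed

section \<open>Monomials on the unit cube\<close>

lemma monomial_0 [simp]: "monomial u 0 = 1"
  by (simp add: monomial_def)

lemma monomial_add: "monomial u (i + j) = monomial u i * monomial u j"
  by (simp add: monomial_def power_add prod.distrib)

lemma monomial_unit_state [simp]: "monomial u (unit_state c) = u $ c"
proof -
  have "monomial u (unit_state c) = (\<Prod>k\<in>UNIV. if k = c then u $ k else 1)"
    unfolding monomial_def by (intro prod.cong) (auto simp: axis_def)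
  then show ?thesis by simp
qed

lemma monomial_nonneg: "(\<And>k. 0 \<le> u $ k) \<Longrightarrow> 0 \<le> monomial u i"
  by (simp add: monomial_def prod_nonneg)

lemma monomial_mono:
  assumes "\<And>k. 0 \<le> u $ k" "\<And>k. u $ k \<le> v $ k"
  shows "monomial u i \<le> monomial v i"
  unfolding monomial_def by (intro prod_mono) (simp add: assms power_mono)

lemma monomial_one [simp]: "monomial 1 i = 1"
  by (simp add: monomial_def)

lemma mem_unit_cube_iff: "(u :: real ^ 'n::finite) \<in> {0..1} \<longleftrightarrow> (\<forall>k. 0 \<le> u $ k \<and> u $ k \<le> 1)"
  by (auto simp: less_eq_vec_def)

lemma monomial_unit_cube:
  assumes "u \<in> {0..1}"
  shows "0 \<le> monomial u i" "monomial u i \<le> 1"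
  using monomial_nonneg[of u i] monomial_mono[of u 1 i] assms unfolding mem_unit_cube_iff by auto

lemma continuous_monomial: "continuous_on A (\<lambda>u. monomial u i)"
  unfolding monomial_def by (intro continuous_intros)

section \<open>Jumps of the process, indexed by families instead of target states\<close>

lemma unit_state_le: "0 < i $ c \<longleftrightarrow> unit_state c \<le> (i :: 'n::finite state)"
  by (auto simp: less_eq_vec_def axis_def)

lemma add_diff_unit_state:
  "unit_state c \<le> i \<Longrightarrow> i + l - unit_state c = (i - unit_state c) + (l :: 'n::finite state)"
  by (auto simp: less_eq_vec_def vec_eq_iff)

lemma diff_unit_state_add:
  "unit_state c \<le> i \<Longrightarrow> (i - unit_state c) + unit_state c = (i :: 'n::finite state)"
  by (auto simp: less_eq_vec_def vec_eq_iff)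

lemma branching_jump_inverse:
  fixes i l :: "'n::finite state"
  assumes "unit_state c \<le> i"
  shows "i + l - unit_state c + unit_state c - i = l"
proof -
  have "i $ m + l $ m - unit_state c $ m + unit_state c $ m - i $ m = l $ m" for m
    using assms[unfolded less_eq_vec_def, rule_format, of m] by linarith
  then show ?thesis by (simp only: vec_eq_iff vector_add_component vector_minus_component) simp
qed

text \<open>A particle of type \<open>c\<close> is replaced by the family \<open>l\<close>. Leaving
  out \<open>l = unit_state c\<close> is the same as leaving out the target \<open>i\<close>, and
  the guard of \<open>q_matrix\<close> describes exactly the states that can be reached.\<close>

lemma bij_betw_branching_jump:
  assumes "unit_state c \<le> i"
  shows "bij_betw (\<lambda>l. i + l - unit_state c) (UNIV - {unit_state c})
           {k. k \<noteq> i \<and> i \<le> k + (unit_state c :: 'n::finite state)}"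
proof (rule bij_betw_byWitness[where f' = "\<lambda>k. k + unit_state c - i"])
  have *: "i \<le> i + l - unit_state c + unit_state c" for l
    using assms by (auto simp: less_eq_vec_def)
  have **: "i + l - unit_state c \<noteq> i" if "l \<noteq> unit_state c" for l
  proof
    assume e: "i + l - unit_state c = i"
    have "l $ m = unit_state c $ m" for m
    proof -
      have "i $ m + l $ m - unit_state c $ m = i $ m" using e by (metis vector_add_component vector_minus_component)
      moreover have "unit_state c $ m \<le> i $ m" using assms by (simp add: less_eq_vec_def)
      ultimately show ?thesis by linarith
    qed
    with that show False by (simp add: vec_eq_iff)
  qed
  from * ** show "(\<lambda>l. i + l - unit_state c) ` (UNIV - {unit_state c}) \<subseteq> {k. k \<noteq> i \<and> i \<le> k + unit_state c}"
    by auto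
  show "(\<lambda>k. k + unit_state c - i) ` {k. k \<noteq> i \<and> i \<le> k + unit_state c} \<subseteq> UNIV - {unit_state c}"
  proof (intro image_subsetI, rule ccontr)
    fix k assume "k \<in> {k. k \<noteq> i \<and> i \<le> k + unit_state c}" "k + unit_state c - i \<notin> UNIV - {unit_state c}"
    then have k: "k \<noteq> i" "i \<le> k + unit_state c" "k + unit_state c - i = unit_state c" by auto
    have "k $ m = i $ m" for m
    proof -
      have "k $ m + unit_state c $ m - i $ m = unit_state c $ m"
        using k(3) by (metis vector_add_component vector_minus_component)
      moreover have "i $ m \<le> k $ m + unit_state c $ m" using k(2) by (simp add: less_eq_vec_def)
      ultimately show ?thesis by linarith
    qed
    with k(1) show False by (simp add: vec_eq_iff)
  qed
  show "\<forall>l\<in>UNIV - {unit_state c}. i + l - unit_state c + unit_state c - i = l"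
    using branching_jump_inverse[OF assms] by blast
  show "\<forall>k\<in>{k. k \<noteq> i \<and> i \<le> k + unit_state c}. i + (k + unit_state c - i) - unit_state c = k"
    by (auto simp: less_eq_vec_def vec_eq_iff)
qed

lemma bij_betw_immigration_jump:
  "bij_betw (\<lambda>l. i + l) (UNIV - {0}) {k. k \<noteq> i \<and> (i :: 'n::finite state) \<le> k}"
  by (rule bij_betw_byWitness[where f' = "\<lambda>k. k - i"])
    (auto simp: less_eq_vec_def vec_eq_iff, metis diff_is_0_eq le_antisym)

text \<open>Change of variables from target state to family. \<open>P\<close> is the guard outside
  which the rate \<open>w\<close> vanishes, and \<open>v\<close> is the rate without its
  guard.\<close>

lemma nn_integral_jump:
  assumes "bij_betw g B {k. k \<noteq> i \<and> P k}" and "\<And>k. P k \<Longrightarrow> w k = v k" "\<And>k. \<not> P k \<Longrightarrow> w k = 0"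
  shows "(\<integral>\<^sup>+k. w k * f k \<partial>count_space (UNIV - {i}))
       = (\<integral>\<^sup>+l. (v (g l) * f (g l) :: ennreal) \<partial>count_space B)"
proof -
  have "(\<integral>\<^sup>+k. w k * f k \<partial>count_space (UNIV - {i}))
      = (\<integral>\<^sup>+k. w k * f k \<partial>count_space {k. k \<noteq> i \<and> P k})"
    by (rule nn_integral_count_space_eq) (auto simp: assms)
  also have "\<dots> = (\<integral>\<^sup>+k. v k * f k \<partial>count_space {k. k \<noteq> i \<and> P k})"
    by (intro nn_integral_cong) (auto simp: assms)
  also have "\<dots> = (\<integral>\<^sup>+l. v (g l) * f (g l) \<partial>count_space B)"
    by (rule nn_integral_bij_count_space[OF assms(1), symmetric])
  finally show ?thesis .
qed

text \<open>Off the diagonal the index cannot be \<open>unit_state c\<close>, the only place where a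
  weight may be negative.\<close>

lemma branching_jump_nonneg:
  fixes i k :: "'n::finite state"
  assumes "\<And>j. j \<noteq> unit_state c \<Longrightarrow> 0 \<le> w j" "k \<noteq> i"
  shows "0 \<le> (if i \<le> k + unit_state c then w (k + unit_state c - i) else (0 :: real))"
proof -
  have "k + unit_state c - i \<noteq> unit_state c" if "i \<le> k + unit_state c"
  proof
    assume e: "k + unit_state c - i = unit_state c"
    have "k $ m = i $ m" for m
    proof -
      have "k $ m + unit_state c $ m - i $ m = unit_state c $ m"
        using e by (metis vector_add_component vector_minus_component)
      moreover have "i $ m \<le> k $ m + unit_state c $ m" using that by (simp add: less_eq_vec_def)
      ultimately show ?thesis by linarith
    qed
    with assms(2) show False by (simp add: vec_eq_iff)
  qed
  then show ?thesis using assms(1) by auto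
qed

lemma immigration_jump_nonneg:
  fixes i k :: "'n::finite state"
  assumes "\<And>j. j \<noteq> 0 \<Longrightarrow> 0 \<le> w j" "k \<noteq> i"
  shows "0 \<le> (if i \<le> k then w (k - i) else (0 :: real))"
proof -
  have "k - i \<noteq> 0" if "i \<le> k"
    using that assms(2) by (auto simp: less_eq_vec_def vec_eq_iff) (metis diff_is_0_eq le_antisym)
  then show ?thesis using assms(1) by auto
qed

lemma q_matrix_nonneg:
  assumes "\<And>c j. j \<noteq> unit_state c \<Longrightarrow> 0 \<le> b c j" "\<And>j. j \<noteq> 0 \<Longrightarrow> 0 \<le> a j" "i \<noteq> k"
  shows "0 \<le> q_matrix a b i k"
  unfolding q_matrix_def
  using assms by (intro add_nonneg_nonneg sum_nonneg mult_nonneg_nonneg branching_jump_nonneg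
      immigration_jump_nonneg) auto

lemma q_matrix_diag: "q_matrix a b i i = (\<Sum>c\<in>UNIV. real (i $ c) * b c (unit_state c)) + a 0"
proof -
  have "i \<le> i + unit_state c" for c :: "'a" by (simp add: less_eq_vec_def)
  moreover have "i + unit_state c - i = unit_state c" for c by (simp add: vec_eq_iff)
  ultimately show ?thesis by (simp add: q_matrix_def)
qed

lemma offdiag_sum_q_matrix:
  fixes f :: "'n::finite state \<Rightarrow> ennreal"
  assumes b: "\<And>c j. j \<noteq> unit_state c \<Longrightarrow> 0 \<le> b c j" and a: "\<And>j. j \<noteq> 0 \<Longrightarrow> 0 \<le> a j"
  shows "offdiag_sum (q_matrix a b) f i =
    (\<Sum>c\<in>UNIV. ennreal (real (i $ c)) *
       (\<integral>\<^sup>+l. ennreal (b c l) * f (i - unit_state c + l) \<partial>count_space (UNIV - {unit_state c})))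
    + (\<integral>\<^sup>+l. ennreal (a l) * f (i + l) \<partial>count_space (UNIV - {0}))"
proof -
  let ?b = "\<lambda>c k. if i \<le> k + unit_state c then b c (k + unit_state c - i) else 0"
  let ?a = "\<lambda>k. if i \<le> k then a (k - i) else 0"
  have Q: "ennreal (q_matrix a b i k)
      = (\<Sum>c\<in>UNIV. ennreal (real (i $ c)) * ennreal (?b c k)) + ennreal (?a k)" if "k \<noteq> i" for k
  proof -
    have 1: "0 \<le> ?b c k" for c by (rule branching_jump_nonneg) (use b that in auto)
    have 2: "0 \<le> ?a k" by (rule immigration_jump_nonneg) (use a that in auto)
    have "ennreal (q_matrix a b i k) = ennreal (\<Sum>c\<in>UNIV. real (i $ c) * ?b c k) + ennreal (?a k)"
      unfolding q_matrix_def by (intro ennreal_plus sum_nonneg mult_nonneg_nonneg 1 2) simp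
    also have "ennreal (\<Sum>c\<in>UNIV. real (i $ c) * ?b c k) = (\<Sum>c\<in>UNIV. ennreal (real (i $ c) * ?b c k))"
      by (intro sum_ennreal[symmetric] mult_nonneg_nonneg 1) simp
    also have "\<dots> = (\<Sum>c\<in>UNIV. ennreal (real (i $ c)) * ennreal (?b c k))"
      by (intro sum.cong refl ennreal_mult 1) simp
    finally show ?thesis .
  qed
  have "offdiag_sum (q_matrix a b) f i
      = (\<integral>\<^sup>+k. (\<Sum>c\<in>UNIV. ennreal (real (i $ c)) * (ennreal (?b c k) * f k)) + ennreal (?a k) * f k
          \<partial>count_space (UNIV - {i}))"
    unfolding offdiag_sum_def
    by (intro nn_integral_cong, subst Q) (simp_all add: distrib_right sum_distrib_right mult.assoc)
  also have "\<dots> = (\<Sum>c\<in>UNIV. ennreal (real (i $ c)) *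
        (\<integral>\<^sup>+k. ennreal (?b c k) * f k \<partial>count_space (UNIV - {i})))
      + (\<integral>\<^sup>+k. ennreal (?a k) * f k \<partial>count_space (UNIV - {i}))"
    by (simp add: nn_integral_add nn_integral_sum nn_integral_cmult)
  also have "(\<integral>\<^sup>+k. ennreal (?a k) * f k \<partial>count_space (UNIV - {i}))
      = (\<integral>\<^sup>+l. ennreal (a (i + l - i)) * f (i + l) \<partial>count_space (UNIV - {0}))"
    by (rule nn_integral_jump[OF bij_betw_immigration_jump, where v = "\<lambda>k. ennreal (a (k - i))"]) simp_all
  finally have *: "offdiag_sum (q_matrix a b) f i = (\<Sum>c\<in>UNIV. ennreal (real (i $ c)) *
        (\<integral>\<^sup>+k. ennreal (?b c k) * f k \<partial>count_space (UNIV - {i})))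
      + (\<integral>\<^sup>+l. ennreal (a (i + l - i)) * f (i + l) \<partial>count_space (UNIV - {0}))" .
  have i: "i + l - i = l" for l by (simp add: vec_eq_iff)
  \<comment> \<open>For \<open>i $ c = 0\<close> the truncated difference
    \<open>i - unit_state c\<close> is not the state meant, but the factor in front is 0.\<close>
  have "ennreal (real (i $ c)) * (\<integral>\<^sup>+k. ennreal (?b c k) * f k \<partial>count_space (UNIV - {i}))
      = ennreal (real (i $ c)) *
        (\<integral>\<^sup>+l. ennreal (b c l) * f (i - unit_state c + l) \<partial>count_space (UNIV - {unit_state c}))" for c
  proof (cases "i $ c = 0")
    case False
    then have le: "unit_state c \<le> i" using unit_state_le[of i c] by simp
    have "(\<integral>\<^sup>+k. ennreal (?b c k) * f k \<partial>count_space (UNIV - {i}))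
      = (\<integral>\<^sup>+l. ennreal (b c (i + l - unit_state c + unit_state c - i)) * f (i + l - unit_state c)
          \<partial>count_space (UNIV - {unit_state c}))"
      by (rule nn_integral_jump[OF bij_betw_branching_jump[OF le],
            where v = "\<lambda>k. ennreal (b c (k + unit_state c - i))"]) simp_all
    then show ?thesis
      by (simp only: branching_jump_inverse[OF le], simp only: add_diff_unit_state[OF le])
  qed simp
  then show ?thesis by (simp add: * i)
qed

text \<open>Generating function without its one possibly negative coefficient, at
  \<open>e = unit_state c\<close> for branching and \<open>e = 0\<close> for immigration. What
  remains is nonnegative and monotone on the cube.\<close>

definition punctured_gf :: "('n::finite state \<Rightarrow> real) \<Rightarrow> 'n state \<Rightarrow> real ^ 'n \<Rightarrow> real" where
  "punctured_gf w e u = (\<Sum>\<^sub>\<infinity>l\<in>UNIV - {e}. w l * monomial u l)"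

definition punctured_weights :: "('n::finite state \<Rightarrow> real) \<Rightarrow> 'n state \<Rightarrow> bool" where
  "punctured_weights w e \<longleftrightarrow> (\<forall>l. l \<noteq> e \<longrightarrow> 0 \<le> w l) \<and> w summable_on (UNIV - {e})"

text \<open>Otherwise the simplifier rewrites \<open>unit_state c\<close>, which abbreviates \<open>axis c 1\<close>, to \<open>axis c (Suc 0)\<close>.\<close>
declare One_nat_def [simp del]

context
  fixes w :: "'n::finite state \<Rightarrow> real" and e :: "'n state"
  assumes weights: "punctured_weights w e"
begin

lemma weight_nonneg: "l \<noteq> e \<Longrightarrow> 0 \<le> w l" and weight_summable: "w summable_on (UNIV - {e})"
  using weights by (auto simp: punctured_weights_def)

lemma punctured_gf_has_sum:
  assumes "u \<in> {0..1}"
  shows "((\<lambda>l. w l * monomial u l) has_sum punctured_gf w e u) (UNIV - {e})"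
  unfolding punctured_gf_def
proof (rule has_sum_infsum, rule summable_on_comparison_test[OF weight_summable])
  show "w l * monomial u l \<le> w l" "0 \<le> w l * monomial u l" if "l \<in> UNIV - {e}" for l
    using that weight_nonneg[of l] monomial_unit_cube[OF assms, of l] by (auto intro: mult_left_le)
qed

lemma punctured_gf_nonneg: "u \<in> {0..1} \<Longrightarrow> 0 \<le> punctured_gf w e u"
  unfolding punctured_gf_def by (intro infsum_nonneg mult_nonneg_nonneg monomial_unit_cube(1) weight_nonneg) auto

lemma punctured_gf_mono:
  assumes "u \<in> {0..1}" "v \<in> {0..1}" "u \<le> v"
  shows "punctured_gf w e u \<le> punctured_gf w e v"
proof (rule has_sum_mono[OF punctured_gf_has_sum[OF assms(1)] punctured_gf_has_sum[OF assms(2)]])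
  show "w l * monomial u l \<le> w l * monomial v l" if "l \<in> UNIV - {e}" for l
    using that assms unfolding mem_unit_cube_iff
    by (intro mult_left_mono monomial_mono weight_nonneg) (auto simp: less_eq_vec_def)
qed

lemma nn_integral_punctured_gf:
  assumes "u \<in> {0..1}"
  shows "(\<integral>\<^sup>+l. ennreal (w l) * ennreal (monomial u l) \<partial>count_space (UNIV - {e}))
       = ennreal (punctured_gf w e u)"
proof -
  have "(\<integral>\<^sup>+l. ennreal (w l) * ennreal (monomial u l) \<partial>count_space (UNIV - {e}))
      = (\<integral>\<^sup>+l. ennreal (w l * monomial u l) \<partial>count_space (UNIV - {e}))"
    using monomial_unit_cube(1)[OF assms] by (intro nn_integral_cong) (simp add: ennreal_mult'')
  also have "\<dots> = ennreal (punctured_gf w e u)"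
    by (rule nn_integral_eq_ennreal_infsum[OF punctured_gf_has_sum[OF assms]])
      (use weight_nonneg monomial_unit_cube(1)[OF assms] in auto)
  finally show ?thesis .
qed

lemma continuous_punctured_gf: "continuous_on {0..1} (punctured_gf w e)"
proof (rule uniform_limit_theorem)
  show "uniform_limit {0..1} (\<lambda>X u. \<Sum>l\<in>X. w l * monomial u l) (punctured_gf w e)
      (finite_subsets_at_top (UNIV - {e}))"
    unfolding punctured_gf_def
  proof (rule Weierstrass_m_test_general[OF _ weight_summable])
    fix l u assume l: "l \<in> UNIV - {e}" and u: "u \<in> {0..1 :: real ^ 'n}"
    show "norm (w l * monomial u l) \<le> w l"
      using l weight_nonneg[of l] monomial_unit_cube[OF u, of l] by (auto simp: abs_mult intro: mult_left_le)
  qed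
  show "\<forall>\<^sub>F X in finite_subsets_at_top (UNIV - {e}). continuous_on {0..1} (\<lambda>u. \<Sum>l\<in>X. w l * monomial u l)"
    by (intro always_eventually allI continuous_intros continuous_monomial)
qed simp

end

lemma monomial_line_through_one: "monomial (line_through 1 j t) l = t ^ (l $ j)"
proof -
  have "monomial (line_through 1 j t) l = (\<Prod>k\<in>UNIV. if k = j then t ^ (l $ k) else 1)"
    unfolding monomial_def line_through_def by (intro prod.cong) auto
  then show ?thesis by simp
qed

locale branching_immigration =
  fixes a :: "'n::finite state \<Rightarrow> real" and b :: "'n \<Rightarrow> 'n state \<Rightarrow> real"
  assumes imm: "immigration_rates a" and bran: "branching_rates b"
begin

text \<open>\<open>G c\<close> is a generating function, not the matrix \<open>G_matrix\<close>.
  With the splitting rate \<open>\<beta> c\<close> it gives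
  \<open>gen_fun b c u = G c u - \<beta> c * u $ c\<close> on the cube.\<close>

abbreviation "G c \<equiv> punctured_gf (b c) (unit_state c)"
abbreviation "A \<equiv> punctured_gf a 0"
abbreviation "\<beta> c \<equiv> - b c (unit_state c)"
abbreviation "Q \<equiv> q_matrix a b"

lemma a_nonneg: "l \<noteq> 0 \<Longrightarrow> 0 \<le> a l"
  using imm by (simp add: immigration_rates_def)

lemma b_nonneg: "l \<noteq> unit_state c \<Longrightarrow> 0 \<le> b c l"
  using bran by (simp add: branching_rates_def)

lemma weights_a: "punctured_weights a 0"
  using imm has_sum_imp_summable by (auto simp: immigration_rates_def punctured_weights_def)

lemma weights_b: "punctured_weights (b c) (unit_state c)"
  using bran has_sum_imp_summable unfolding branching_rates_def punctured_weights_def by blast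

lemma beta_pos: "0 < \<beta> c"
  using bran unfolding branching_rates_def by blast

lemmas G_has_sum = punctured_gf_has_sum[OF weights_b]
  and G_nonneg = punctured_gf_nonneg[OF weights_b]
  and G_mono = punctured_gf_mono[OF weights_b]
  and nn_integral_G = nn_integral_punctured_gf[OF weights_b]
  and continuous_G = continuous_punctured_gf[OF weights_b]
  and A_nonneg = punctured_gf_nonneg[OF weights_a]
  and A_mono = punctured_gf_mono[OF weights_a]
  and nn_integral_A = nn_integral_punctured_gf[OF weights_a]
  and continuous_A = continuous_punctured_gf[OF weights_a]

lemma gen_fun_has_sum:
  assumes "u \<in> {0..1}"
  shows "((\<lambda>l. b c l * monomial u l) has_sum (G c u - \<beta> c * u $ c)) UNIV"
  using has_sum_insert[OF _ G_has_sum[OF assms, of c], of "unit_state c"]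
  by (simp add: insert_absorb add.commute)

lemma gen_fun_eq: "u \<in> {0..1} \<Longrightarrow> gen_fun b c u = G c u - \<beta> c * u $ c"
  unfolding gen_fun_def by (rule infsumI[OF gen_fun_has_sum])

text \<open>Monomials are multiplicative in the jump, so summing over families yields the generating
  functions.\<close>

lemma offdiag_sum_monomial:
  assumes u: "u \<in> {0..1}"
  shows "offdiag_sum Q (\<lambda>k. ennreal (monomial u k)) i
    = ennreal ((\<Sum>c\<in>UNIV. real (i $ c) * (monomial u (i - unit_state c) * G c u)) + monomial u i * A u)"
proof -
  have m: "ennreal (monomial u (i + l)) = ennreal (monomial u i) * ennreal (monomial u l)" for i l
    by (simp add: monomial_add ennreal_mult monomial_unit_cube(1)[OF u])
  have 1: "(\<integral>\<^sup>+l. ennreal (b c l) * ennreal (monomial u (i - unit_state c + l)) \<partial>count_space (UNIV - {unit_state c}))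
      = ennreal (monomial u (i - unit_state c) * G c u)" for c
    using nn_integral_G[OF u, of c]
    by (simp add: m mult.left_commute[of "ennreal (b c _)"] nn_integral_cmult ennreal_mult
        monomial_unit_cube(1)[OF u] G_nonneg[OF u])
  have 2: "(\<integral>\<^sup>+l. ennreal (a l) * ennreal (monomial u (i + l)) \<partial>count_space (UNIV - {0}))
      = ennreal (monomial u i * A u)"
    using nn_integral_A[OF u]
    by (simp add: m mult.left_commute[of "ennreal (a _)"] nn_integral_cmult ennreal_mult
        monomial_unit_cube(1)[OF u] A_nonneg[OF u])
  have "0 \<le> monomial u j * G c u" "0 \<le> monomial u j * A u" for c j
    by (simp_all add: monomial_unit_cube(1)[OF u] G_nonneg[OF u] A_nonneg[OF u])
  then show ?thesis
    by (subst offdiag_sum_q_matrix)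
      (simp_all add: b_nonneg a_nonneg 1 2 ennreal_mult'[symmetric] sum_nonneg)
qed

text \<open>Along the line through the corner, \<open>1 - t ^ r\<close> divided by
  \<open>1 - t\<close> is a geometric sum with limit \<open>r\<close>. A finite one-sided derivative
  bounds the difference quotients of \<open>gen_fun b c\<close> near 1, hence every finite partial
  sum of the mean by one constant.\<close>

lemma mean_summable:
  assumes "has_finite_partial (gen_fun b c) j 1"
  shows "(\<lambda>l. b c l * real (l $ j)) summable_on (UNIV - {unit_state c})"
proof -
  define f where "f t = gen_fun b c (line_through 1 j t)" for t
  have cube: "line_through 1 j t \<in> {0..1 :: real ^ 'n}" if "0 \<le> t" "t \<le> 1" for t
    unfolding mem_unit_cube_iff using that by (simp add: line_through_def)
  obtain D where "(f has_real_derivative D) (at 1 within {0..1})"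
    using assms by (auto simp: has_finite_partial_def f_def[symmetric] real_differentiable_def)
  then have "((\<lambda>t. (f t - f 1) / (t - 1)) \<longlongrightarrow> D) (at 1 within {0..1})"
    by (simp add: has_field_derivative_iff)
  then have ev: "\<forall>\<^sub>F t in at 1 within {0..1}. (f t - f 1) / (t - 1) < D + 1"
    by (rule order_tendstoD) simp
  \<comment> \<open>\<open>D + 1\<close> bounds the difference quotients near 1, and
    \<open>\<beta> c\<close> compensates for the term that \<open>G c\<close> leaves out.\<close>
  define M where "M = D + 1 + \<beta> c"
  have "(\<Sum>l\<in>F. b c l * real (l $ j)) \<le> M" if F: "finite F" "F \<subseteq> UNIV - {unit_state c}" for F
  proof (rule tendsto_upperbound)
    have "((\<lambda>t. \<Sum>l\<in>F. b c l * (\<Sum>r<l $ j. t ^ r)) \<longlongrightarrow> (\<Sum>l\<in>F. b c l * (\<Sum>r<l $ j. 1 ^ r)))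
        (at 1 within {0..1::real})"
      by (intro tendsto_intros)
    then show "((\<lambda>t. \<Sum>l\<in>F. b c l * (\<Sum>r<l $ j. t ^ r)) \<longlongrightarrow> (\<Sum>l\<in>F. b c l * real (l $ j)))
        (at 1 within {0..1::real})" by simp
    show "\<forall>\<^sub>F t in at 1 within {0..1}. (\<Sum>l\<in>F. b c l * (\<Sum>r<l $ j. t ^ r)) \<le> M"
      using ev unfolding eventually_at_filter
    proof eventually_elim
      fix t :: real assume *: "t \<noteq> 1 \<longrightarrow> t \<in> {0..1} \<longrightarrow> (f t - f 1) / (t - 1) < D + 1"
      show "t \<noteq> 1 \<longrightarrow> t \<in> {0..1} \<longrightarrow> (\<Sum>l\<in>F. b c l * (\<Sum>r<l $ j. t ^ r)) \<le> M"
      proof (intro impI)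
        assume t: "t \<noteq> 1" "t \<in> {0..1}"
        then have t': "0 \<le> t" "t < 1" by auto
        have ft: "f s = G c (line_through 1 j s) - \<beta> c * s ^ (unit_state c $ j)" if "0 \<le> s" "s \<le> 1" for s
          unfolding f_def gen_fun_eq[OF cube[OF that]]
          using monomial_line_through_one[of j s "unit_state c"] by simp
        have "(\<Sum>l\<in>F. b c l * (1 - t ^ (l $ j))) \<le> G c (line_through 1 j 1) - G c (line_through 1 j t)"
        proof -
          have "((\<lambda>l. b c l * 1 ^ (l $ j) + - (b c l * t ^ (l $ j)))
             has_sum (G c (line_through 1 j 1) + - G c (line_through 1 j t))) (UNIV - {unit_state c})"
            using G_has_sum[OF cube[of 1], of c] G_has_sum[OF cube[of t], of c] t'
            unfolding monomial_line_through_one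
            by (intro has_sum_add has_sum_uminusI) simp_all
          then have h: "((\<lambda>l. b c l * (1 - t ^ (l $ j)))
             has_sum (G c (line_through 1 j 1) - G c (line_through 1 j t))) (UNIV - {unit_state c})"
            by (simp add: algebra_simps)
          show ?thesis
            by (rule has_sum_mono2[OF has_sum_finite[OF F(1)] h F(2)])
              (use t' in \<open>auto intro!: mult_nonneg_nonneg b_nonneg simp: power_le_one\<close>)
        qed
        also have "\<dots> = f 1 - f t + \<beta> c * (1 - t ^ (unit_state c $ j))"
          using ft[of 1] ft[of t] t' by (simp add: algebra_simps)
        also have "\<dots> \<le> (D + 1) * (1 - t) + \<beta> c * (1 - t)"
        proof (rule add_mono)
          have "(f t - f 1) / (t - 1) < D + 1" using * t by simp
          then show "f 1 - f t \<le> (D + 1) * (1 - t)" using t' by (simp add: field_simps)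
          have "t \<le> t ^ (unit_state c $ j)" using t' by (cases "c = j") (auto simp: axis_def)
          then show "\<beta> c * (1 - t ^ (unit_state c $ j)) \<le> \<beta> c * (1 - t)"
            using beta_pos[of c] by (intro mult_left_mono) auto
        qed
        finally have "(\<Sum>l\<in>F. b c l * (1 - t ^ (l $ j))) \<le> M * (1 - t)"
          by (simp add: M_def algebra_simps)
        moreover have "(\<Sum>l\<in>F. b c l * (1 - t ^ (l $ j)))
            = (\<Sum>l\<in>F. b c l * (\<Sum>r<l $ j. t ^ r)) * (1 - t)"
          unfolding sum_distrib_right
          by (intro sum.cong refl) (simp add: one_diff_power_eq mult_ac)
        ultimately show "(\<Sum>l\<in>F. b c l * (\<Sum>r<l $ j. t ^ r)) \<le> M"
          using t' by simp
      qed
    qed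
    show "at 1 within {0..1::real} \<noteq> bot"
      by (simp add: trivial_limit_within)
  qed
  note bound = this
  show ?thesis
  proof (rule nonneg_bdd_above_summable_on)
    show "0 \<le> b c l * real (l $ j)" if "l \<in> UNIV - {unit_state c}" for l
      using that b_nonneg[of l c] by simp
    show "bdd_above (sum (\<lambda>l. b c l * real (l $ j)) ` {F. F \<subseteq> UNIV - {unit_state c} \<and> finite F})"
      by (rule bdd_aboveI2[where M = M], rule bound) auto
  qed
qed

end

section \<open>Non-explosion at a root\<close>

definition population :: "'n::finite state \<Rightarrow> real" where
  "population l = (\<Sum>m\<in>UNIV. real (l $ m))"

lemma summable_on_sum_finite:
  fixes f :: "'i \<Rightarrow> 'a \<Rightarrow> real"
  assumes "finite I" and "\<And>i. i \<in> I \<Longrightarrow> f i summable_on S"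
  shows "(\<lambda>x. \<Sum>i\<in>I. f i x) summable_on S"
  using assms by (induction I rule: finite_induct) (auto intro: summable_on_add)

lemma population_nonneg: "0 \<le> population l"
  by (simp add: population_def sum_nonneg)

lemma population_add: "population (i + l) = population i + population l"
  by (simp add: population_def sum.distrib)

lemma component_le_population: "real (i $ c) \<le> population i"
  unfolding population_def by (rule member_le_sum) auto

lemma monomial_diff_unit_state:
  assumes "0 < i $ c"
  shows "monomial u (i - unit_state c) * u $ c = monomial u i"
  using monomial_add[of u "i - unit_state c" "unit_state c"] assms
  by (simp add: diff_unit_state_add unit_state_le)

lemma population_diff_unit_state_le: "population (i - unit_state c) \<le> population i"
  unfolding population_def by (intro sum_mono) simp

locale rooted_branching_immigration = branching_immigration a b
  for a :: "'n::finite state \<Rightarrow> real" and b :: "'n \<Rightarrow> 'n state \<Rightarrow> real" +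
  fixes q :: "real ^ 'n"
  assumes q_cube: "q \<in> {0..1}" and root: "gen_fun b c q = 0"
begin

text \<open>\<open>- \<mu>\<close> is the full generating function of immigration at
  \<open>q\<close>; \<open>a 0\<close> is the term missing from \<open>A\<close>.\<close>

abbreviation "\<mu> \<equiv> - a 0 - A q"

lemma G_root: "G c q = \<beta> c * q $ c"
  using root[of c] gen_fun_eq[OF q_cube, of c] by simp

lemma q_nonneg: "0 \<le> q $ c"
  using q_cube unfolding mem_unit_cube_iff by blast

lemma total_rate: "- \<mu> - Q i i = (\<Sum>c\<in>UNIV. real (i $ c) * \<beta> c) + A q"
  by (simp add: q_matrix_diag sum_negf)

text \<open>At a root, \<open>monomial q (i - unit_state c) * G c q\<close> equals
  \<open>\<beta> c * monomial q i\<close> if \<open>i $ c\<close> is positive, so branching gains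
  and losses cancel. Only immigration is left, and it contributes the same factor at every
  state.\<close>

sublocale weighted_q_matrix Q "monomial q" \<mu>
proof
  show "0 \<le> monomial q j" for j by (rule monomial_unit_cube(1)[OF q_cube])
  show "0 \<le> - \<mu> - Q i i" for i
    unfolding total_rate
    by (intro add_nonneg_nonneg sum_nonneg mult_nonneg_nonneg A_nonneg[OF q_cube] less_imp_le[OF beta_pos]) simp
  have *: "real (i $ c) * (monomial q (i - unit_state c) * G c q) = real (i $ c) * \<beta> c * monomial q i" for i c
    using monomial_diff_unit_state[of i c q] by (cases "i $ c = 0") (simp_all add: G_root mult_ac)
  then show "offdiag_sum Q (\<lambda>k. ennreal (monomial q k)) i = ennreal ((- \<mu> - Q i i) * monomial q i)" for i
    unfolding offdiag_sum_monomial[OF q_cube] total_rate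
    by (simp only: * distrib_right sum_distrib_right mult.commute[of "monomial q i" "A q"])
qed

lemma Q_nonneg: "i \<noteq> j \<Longrightarrow> 0 \<le> Q i j"
  by (rule q_matrix_nonneg) (simp_all add: a_nonneg b_nonneg)

lemma Q_monomial_has_sum: "((\<lambda>j. Q i j * monomial q j) has_sum (- \<mu> * monomial q i)) UNIV"
proof -
  have "(\<integral>\<^sup>+j. ennreal (Q i j * monomial q j) \<partial>count_space (UNIV - {i}))
      = ennreal ((- \<mu> - Q i i) * monomial q i)"
    unfolding offdiag_sum_y[symmetric] offdiag_sum_def
    by (intro nn_integral_cong ennreal_mult'' y_nonneg)
  then have "((\<lambda>j. Q i j * monomial q j) has_sum ((- \<mu> - Q i i) * monomial q i)) (UNIV - {i})"
    using y_nonneg Q_nonneg rate_nonneg[of i] by (intro has_sum_if_nn_integral) (auto intro!: mult_nonneg_nonneg)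
  from has_sum_insert[OF _ this, of i] show ?thesis
    by (simp add: insert_absorb algebra_simps)
qed

text \<open>Immigrant families outside a finite set \<open>F\<close> are split off: their rate is small, and the
  remaining family sizes have finite means.\<close>

lemma defect_vanishes:
  assumes q_pos: "\<And>c. 0 < q $ c"
    and mean: "\<And>c j. (\<lambda>l. b c l * real (l $ j)) summable_on (UNIV - {unit_state c})"
    and "0 \<le> t"
  shows "(\<lambda>m. defect m t i) \<longlonglongrightarrow> 0"
\<comment> \<open>Exit rates grow at most linearly in the number of particles, hence this Lyapunov
  function; the 1 makes it at least 1 at the empty state.\<close>
proof (rule defect_tendsto_0[where V = "\<lambda>i. 1 + population i" and K = "(\<Sum>c\<in>UNIV. \<beta> c) + A q"])
  show "1 \<le> 1 + population i" for i :: "'n state" by (simp add: population_nonneg)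
  have Bpos: "0 \<le> (\<Sum>c\<in>UNIV. \<beta> c)" by (intro sum_nonneg less_imp_le[OF beta_pos])
  show K: "0 \<le> (\<Sum>c\<in>UNIV. \<beta> c) + A q"
    using Bpos A_nonneg[OF q_cube] by simp
  show "- \<mu> - Q i i \<le> ((\<Sum>c\<in>UNIV. \<beta> c) + A q) * (1 + population i)" for i
  proof -
    have "(\<Sum>c\<in>UNIV. real (i $ c) * \<beta> c) \<le> (\<Sum>c\<in>UNIV. (1 + population i) * \<beta> c)"
      using component_le_population[of i] beta_pos
      by (intro sum_mono mult_right_mono) (auto intro: less_imp_le add_increasing)
    moreover have "A q \<le> A q * (1 + population i)"
      using A_nonneg[OF q_cube] population_nonneg[of i] by (simp add: algebra_simps)
    ultimately show ?thesis
      unfolding total_rate by (simp add: sum_distrib_left algebra_simps)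
  qed
  show "0 \<le> t" by fact
  fix \<delta> :: real assume "0 < \<delta>"
  define M where "M c = (\<Sum>\<^sub>\<infinity>l\<in>UNIV - {unit_state c}. b c l * population l)" for c
  have M: "((\<lambda>l. b c l * population l) has_sum M c) (UNIV - {unit_state c})" for c
    unfolding M_def population_def sum_distrib_left
    by (intro has_sum_infsum summable_on_sum_finite mean) simp
  have M_integral: "(\<integral>\<^sup>+l. ennreal (b c l * population l) \<partial>count_space (UNIV - {unit_state c})) = ennreal (M c)" for c
    by (rule nn_integral_eq_ennreal_infsum[OF M]) (simp add: b_nonneg population_nonneg)
  have M_nonneg: "0 \<le> M c" for c
    unfolding M_def by (intro infsum_nonneg mult_nonneg_nonneg b_nonneg population_nonneg) auto
  have a_sum: "(a has_sum - a 0) (UNIV - {0})"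
    using imm by (simp add: immigration_rates_def)
  obtain F where F: "finite F" "F \<subseteq> UNIV - {0}" and tail: "- a 0 - sum a F < \<delta>"
  proof -
    have "\<forall>\<^sub>F F in finite_subsets_at_top (UNIV - {0}). - a 0 - \<delta> < sum a F"
      using a_sum unfolding has_sum_def by (rule order_tendstoD) (use \<open>0 < \<delta>\<close> in simp)
    then show ?thesis
      using that unfolding eventually_finite_subsets_at_top by fastforce
  qed
  define a1 where "a1 l = (if l \<in> F then a l else 0)" for l
  define a2 where "a2 l = (if l \<in> F then 0 else a l)" for l
  define N where "N = (\<Sum>l\<in>F. a l * population l)"
  \<comment> \<open>Removing a particle of type \<open>c\<close> divides the weight by
    \<open>q $ c\<close>, which explains the quotient and the use of \<open>q_pos\<close>.
    \<open>N\<close> comes from the finitely many immigrant families in \<open>F\<close>.\<close>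
  define C where "C = (\<Sum>c\<in>UNIV. M c / q $ c) + N"
  have a12: "0 \<le> a1 l" "0 \<le> a2 l" if "l \<noteq> 0" for l
    using that a_nonneg[of l] by (auto simp: a1_def a2_def)
  have N_nonneg: "0 \<le> N"
    unfolding N_def using F(2) by (intro sum_nonneg mult_nonneg_nonneg a_nonneg population_nonneg) auto
  have C: "0 \<le> C"
    unfolding C_def using M_nonneg N_nonneg q_nonneg by (intro add_nonneg_nonneg sum_nonneg) auto
  have Q12: "Q i k = q_matrix a1 b i k + q_matrix a2 (\<lambda>_ _. 0) i k" for i k
    by (simp add: q_matrix_def a1_def a2_def)
  have Q1: "offdiag_sum (q_matrix a1 b) (\<lambda>k. ennreal (monomial q k * (1 + population k))) i
      \<le> ennreal ((- \<mu> - Q i i + C) * (monomial q i * (1 + population i)))" for i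
  proof -
    let ?V = "1 + population i"
    have V: "0 \<le> ?V" using population_nonneg[of i] by simp
    have bterm: "ennreal (real (i $ c)) * (\<integral>\<^sup>+l. ennreal (b c l) *
        ennreal (monomial q (i - unit_state c + l) * (1 + population (i - unit_state c + l)))
          \<partial>count_space (UNIV - {unit_state c}))
      \<le> ennreal (monomial q i * ?V * (real (i $ c) * \<beta> c + M c / q $ c))" for c
    proof (cases "i $ c = 0")
      case True
      then show ?thesis by simp
    next
      case False
      define d where "d = monomial q (i - unit_state c)"
      have d: "0 \<le> d" by (simp add: d_def y_nonneg)
      have dq: "d * q $ c = monomial q i"
        using monomial_diff_unit_state[of i c q] False by (simp add: d_def)
      have "(\<integral>\<^sup>+l. ennreal (b c l) *
          ennreal (monomial q (i - unit_state c + l) * (1 + population (i - unit_state c + l)))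
            \<partial>count_space (UNIV - {unit_state c}))
        \<le> (\<integral>\<^sup>+l. ennreal (d * ?V) * (ennreal (b c l) * ennreal (monomial q l))
            + ennreal d * ennreal (b c l * population l) \<partial>count_space (UNIV - {unit_state c}))"
      proof (rule nn_integral_mono)
        fix l assume "l \<in> space (count_space (UNIV - {unit_state c}))"
        then have l: "0 \<le> b c l" by (simp add: b_nonneg)
        have t: "0 \<le> population l" "0 \<le> population (i - unit_state c)" by (rule population_nonneg)+
        have "monomial q (i - unit_state c + l) * (1 + population (i - unit_state c + l))
            = d * (monomial q l * (1 + population (i - unit_state c)) + monomial q l * population l)"
          by (simp add: monomial_add population_add d_def algebra_simps)
        \<comment> \<open>Only next to \<open>population l\<close> is \<open>monomial q l\<close>
          replaced by 1. In the main term it stays, so that the sum is \<open>G c q\<close> and the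
          exit rate appears without loss.\<close>
        also have "\<dots> \<le> d * (monomial q l * ?V + 1 * population l)"
          using monomial_unit_cube[OF q_cube, of l] population_diff_unit_state_le[of i c] t d
          by (intro mult_left_mono add_mono mult_right_mono) auto
        finally have "b c l * (monomial q (i - unit_state c + l) * (1 + population (i - unit_state c + l)))
            \<le> b c l * (d * (monomial q l * ?V + 1 * population l))"
          using l by (rule mult_left_mono)
        also have "\<dots> = d * ?V * (b c l * monomial q l) + d * (b c l * population l)"
          by (simp add: algebra_simps)
        finally show "ennreal (b c l) * ennreal (monomial q (i - unit_state c + l) * (1 + population (i - unit_state c + l)))
            \<le> ennreal (d * ?V) * (ennreal (b c l) * ennreal (monomial q l)) + ennreal d * ennreal (b c l * population l)"
          using l d V t y_nonneg[of l]
          by (simp add: ennreal_mult'[symmetric] ennreal_plus[symmetric] ennreal_leI del: ennreal_plus)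
      qed
      also have "\<dots> = ennreal (d * ?V) * ennreal (G c q) + ennreal d * ennreal (M c)"
        by (simp add: nn_integral_add nn_integral_cmult nn_integral_G[OF q_cube] M_integral)
      also have "\<dots> = ennreal (d * ?V * G c q + d * M c)"
        using d V G_nonneg[OF q_cube, of c] M_nonneg[of c]
        by (simp add: ennreal_mult'[symmetric] ennreal_plus[symmetric] del: ennreal_plus)
      also have "d * ?V * G c q + d * M c = monomial q i * (?V * \<beta> c + M c / q $ c)"
        using q_pos[of c] by (simp add: dq[symmetric] G_root field_simps)
      finally have "ennreal (real (i $ c)) * (\<integral>\<^sup>+l. ennreal (b c l) *
          ennreal (monomial q (i - unit_state c + l) * (1 + population (i - unit_state c + l)))
            \<partial>count_space (UNIV - {unit_state c}))
        \<le> ennreal (real (i $ c)) * ennreal (monomial q i * (?V * \<beta> c + M c / q $ c))"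
        by (rule mult_left_mono) simp
      also have "\<dots> = ennreal (monomial q i * (?V * (real (i $ c) * \<beta> c) + real (i $ c) * (M c / q $ c)))"
        by (simp add: ennreal_mult'[symmetric] algebra_simps)
      \<comment> \<open>The number of type \<open>c\<close> particles is at most \<open>?V\<close>;
        thus the mean offspring numbers give a term linear in \<open>V\<close>, to be absorbed in
        \<open>C\<close>.\<close>
      also have "\<dots> \<le> ennreal (monomial q i * (?V * (real (i $ c) * \<beta> c) + ?V * (M c / q $ c)))"
        using component_le_population[of i c] M_nonneg[of c] q_pos[of c]
        by (intro ennreal_leI mult_left_mono add_left_mono mult_right_mono y_nonneg) (auto intro: less_imp_le)
      also have "monomial q i * (?V * (real (i $ c) * \<beta> c) + ?V * (M c / q $ c))
          = monomial q i * ?V * (real (i $ c) * \<beta> c + M c / q $ c)"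
        by (simp only: distrib_left distrib_right mult.assoc add.assoc)
      finally show ?thesis .
    qed
    have aterm: "(\<integral>\<^sup>+l. ennreal (a1 l) * ennreal (monomial q (i + l) * (1 + population (i + l))) \<partial>count_space (UNIV - {0}))
      \<le> ennreal (monomial q i * ?V * (A q + N))"
    proof -
      have "(\<integral>\<^sup>+l. ennreal (a1 l) * ennreal (monomial q (i + l) * (1 + population (i + l))) \<partial>count_space (UNIV - {0}))
        \<le> (\<integral>\<^sup>+l. ennreal (monomial q i * ?V) * (ennreal (a l) * ennreal (monomial q l))
            + ennreal (monomial q i) * ennreal (a1 l * population l) \<partial>count_space (UNIV - {0}))"
      proof (rule nn_integral_mono)
        fix l assume "l \<in> space (count_space (UNIV - {0 :: 'n state}))"
        then have l: "0 \<le> a1 l" "0 \<le> a l" "a1 l \<le> a l" using a_nonneg[of l] by (auto simp: a1_def)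
        have t: "0 \<le> population l" by (rule population_nonneg)
        have "a1 l * (monomial q (i + l) * (1 + population (i + l)))
            = monomial q i * ?V * (a1 l * monomial q l) + monomial q i * (a1 l * (monomial q l * population l))"
          by (simp add: monomial_add population_add algebra_simps)
        \<comment> \<open>The main term is enlarged from \<open>a1\<close> to \<open>a\<close>, so
          that \<open>A q\<close> appears; the other one keeps \<open>a1\<close>, whose mean is the
          finite sum \<open>N\<close>.\<close>
        also have "\<dots> \<le> monomial q i * ?V * (a l * monomial q l) + monomial q i * (a1 l * (1 * population l))"
          using l t V y_nonneg monomial_unit_cube[OF q_cube, of l]
          by (intro add_mono mult_left_mono mult_right_mono mult_nonneg_nonneg) auto
        finally show "ennreal (a1 l) * ennreal (monomial q (i + l) * (1 + population (i + l)))
            \<le> ennreal (monomial q i * ?V) * (ennreal (a l) * ennreal (monomial q l))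
            + ennreal (monomial q i) * ennreal (a1 l * population l)"
          using l V t y_nonneg
          by (simp add: ennreal_mult'[symmetric] ennreal_plus[symmetric] ennreal_leI del: ennreal_plus)
      qed
      also have "\<dots> = ennreal (monomial q i * ?V) * ennreal (A q)
          + ennreal (monomial q i) * (\<integral>\<^sup>+l. ennreal (a1 l * population l) \<partial>count_space (UNIV - {0}))"
        by (simp add: nn_integral_add nn_integral_cmult nn_integral_A[OF q_cube])
      also have "(\<integral>\<^sup>+l. ennreal (a1 l * population l) \<partial>count_space (UNIV - {0})) = (\<Sum>l\<in>F. ennreal (a1 l * population l))"
        by (rule nn_integral_count_space') (use F in \<open>auto simp: a1_def\<close>)
      also have "\<dots> = ennreal (\<Sum>l\<in>F. a1 l * population l)"
        using F(2) by (intro sum_ennreal mult_nonneg_nonneg a12(1) population_nonneg) auto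
      also have "(\<Sum>l\<in>F. a1 l * population l) = N"
        by (simp add: N_def a1_def)
      also have "ennreal (monomial q i * ?V) * ennreal (A q) + ennreal (monomial q i) * ennreal N
          = ennreal (monomial q i * ?V * A q + monomial q i * N)"
        using V y_nonneg A_nonneg[OF q_cube] N_nonneg
        by (simp add: ennreal_mult'[symmetric] ennreal_plus[symmetric] del: ennreal_plus)
      also have "\<dots> \<le> ennreal (monomial q i * ?V * (A q + N))"
        using N_nonneg population_nonneg[of i] y_nonneg[of i] by (intro ennreal_leI) (simp add: algebra_simps)
      finally show ?thesis .
    qed
    have nn: "0 \<le> monomial q i * ?V * (real (i $ c) * \<beta> c + M c / q $ c)" for c
      by (intro mult_nonneg_nonneg[OF mult_nonneg_nonneg[OF y_nonneg V]] add_nonneg_nonneg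
          mult_nonneg_nonneg divide_nonneg_nonneg of_nat_0_le_iff less_imp_le[OF beta_pos] M_nonneg q_nonneg)
    have "offdiag_sum (q_matrix a1 b) (\<lambda>k. ennreal (monomial q k * (1 + population k))) i
      \<le> (\<Sum>c\<in>UNIV. ennreal (monomial q i * ?V * (real (i $ c) * \<beta> c + M c / q $ c)))
        + ennreal (monomial q i * ?V * (A q + N))"
      by (subst offdiag_sum_q_matrix, erule b_nonneg, erule a12(1))
        (intro add_mono sum_mono bterm aterm)
    also have "\<dots> = ennreal ((\<Sum>c\<in>UNIV. monomial q i * ?V * (real (i $ c) * \<beta> c + M c / q $ c))
        + monomial q i * ?V * (A q + N))"
      using V y_nonneg A_nonneg[OF q_cube] N_nonneg nn
      by (subst ennreal_plus) (auto simp: sum_nonneg)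
    also have "(\<Sum>c\<in>UNIV. monomial q i * ?V * (real (i $ c) * \<beta> c + M c / q $ c))
        + monomial q i * ?V * (A q + N) = (- \<mu> - Q i i + C) * (monomial q i * ?V)"
      unfolding total_rate C_def sum_distrib_left[symmetric] sum.distrib by (simp add: algebra_simps)
    finally show ?thesis .
  qed
  have Q2: "offdiag_sum (q_matrix a2 (\<lambda>_ _. 0)) (\<lambda>k. ennreal (monomial q k)) i \<le> ennreal (\<delta> * monomial q i)" for i
  proof -
    have "(a has_sum (- a 0 - sum a F)) (UNIV - {0} - F)"
      by (rule has_sum_Diff[OF a_sum has_sum_finite[OF F(1)] F(2)])
    then have "(\<integral>\<^sup>+l. ennreal (a l) \<partial>count_space (UNIV - {0} - F)) = ennreal (- a 0 - sum a F)"
      by (rule nn_integral_eq_ennreal_infsum) (simp add: a_nonneg)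
    moreover have "(\<integral>\<^sup>+l. ennreal (a2 l) \<partial>count_space (UNIV - {0}))
        = (\<integral>\<^sup>+l. ennreal (a2 l) \<partial>count_space (UNIV - {0} - F))"
      by (rule nn_integral_count_space_eq) (auto simp: a2_def)
    moreover have "\<dots> = (\<integral>\<^sup>+l. ennreal (a l) \<partial>count_space (UNIV - {0} - F))"
      by (intro nn_integral_cong) (auto simp: a2_def)
    ultimately have *: "(\<integral>\<^sup>+l. ennreal (a2 l) \<partial>count_space (UNIV - {0})) = ennreal (- a 0 - sum a F)"
      by simp
    have "offdiag_sum (q_matrix a2 (\<lambda>_ _. 0)) (\<lambda>k. ennreal (monomial q k)) i
        = (\<integral>\<^sup>+l. ennreal (a2 l) * ennreal (monomial q (i + l)) \<partial>count_space (UNIV - {0}))"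
      by (subst offdiag_sum_q_matrix) (simp_all add: a12)
    also have "\<dots> \<le> (\<integral>\<^sup>+l. ennreal (a2 l) * ennreal (monomial q i) \<partial>count_space (UNIV - {0}))"
      using y_nonneg[of i] monomial_unit_cube[OF q_cube]
      by (intro nn_integral_mono mult_left_mono ennreal_leI) (simp_all add: monomial_add mult_left_le)
    also have "\<dots> = ennreal (- a 0 - sum a F) * ennreal (monomial q i)"
      by (simp add: nn_integral_multc *)
    also have "\<dots> \<le> ennreal \<delta> * ennreal (monomial q i)"
      using tail by (intro mult_right_mono ennreal_leI) auto
    finally show ?thesis using \<open>0 < \<delta>\<close> by (simp add: ennreal_mult')
  qed
  show "\<exists>C\<ge>0. \<exists>Q1 Q2.
      (\<forall>i k. i \<noteq> k \<longrightarrow> Q i k = Q1 i k + Q2 i k \<and> 0 \<le> Q1 i k \<and> 0 \<le> Q2 i k) \<and>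
      (\<forall>i. offdiag_sum Q1 (\<lambda>k. ennreal (monomial q k * (1 + population k))) i
          \<le> ennreal ((- \<mu> - Q i i + C) * (monomial q i * (1 + population i)))) \<and>
      (\<forall>i. offdiag_sum Q2 (\<lambda>k. ennreal (monomial q k)) i \<le> ennreal (\<delta> * monomial q i))"
  proof (rule exI[of _ C], rule conjI[OF C], rule exI[of _ "q_matrix a1 b"],
      rule exI[of _ "q_matrix a2 (\<lambda>_ _. 0)"], intro conjI allI impI)
    fix i k :: "'n state" assume "i \<noteq> k"
    then show "0 \<le> q_matrix a1 b i k" "0 \<le> q_matrix a2 (\<lambda>_ _. 0) i k"
      by (intro q_matrix_nonneg a12 b_nonneg; simp)+
  qed (rule Q12 Q1 Q2)+
qed

end

section \<open>Subsolutions from Picard iterates\<close>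

text \<open>The product rule, in the shape of \<open>offdiag_sum_monomial\<close>. Truncation in
  \<open>i - unit_state c\<close> is harmless, since for \<open>i $ c = 0\<close> the term
  vanishes.\<close>

lemma has_real_derivative_monomial:
  assumes "\<And>c. ((\<lambda>t. f t $ c) has_real_derivative f' c) (at t within S)"
  shows "((\<lambda>t. monomial (f t) i) has_real_derivative
           (\<Sum>c\<in>UNIV. real (i $ c) * monomial (f t) (i - unit_state c) * f' c)) (at t within S)"
proof -
  let ?D = "\<lambda>c. real (i $ c) * f t $ c ^ (i $ c - 1) * f' c"
  have "((\<lambda>t. f t $ c ^ (i $ c)) has_real_derivative ?D c) (at t within S)" for c
    using DERIV_power[OF assms[of c], of "i $ c"] by (simp add: mult_ac One_nat_def)
  then have "((\<lambda>t. f t $ c ^ (i $ c)) has_derivative (\<lambda>y. ?D c * y)) (at t within S)" for c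
    unfolding has_field_derivative_def .
  then have "((\<lambda>t. \<Prod>c\<in>UNIV. f t $ c ^ (i $ c)) has_derivative
      (\<lambda>y. \<Sum>c\<in>UNIV. ?D c * y * (\<Prod>d\<in>UNIV - {c}. f t $ d ^ (i $ d)))) (at t within S)"
    by (rule has_derivative_prod)
  moreover have "?D c * y * (\<Prod>d\<in>UNIV - {c}. f t $ d ^ (i $ d))
      = real (i $ c) * monomial (f t) (i - unit_state c) * f' c * y" for c y
  proof -
    have "(\<Prod>d\<in>UNIV - {c}. f t $ d ^ ((i - unit_state c) $ d)) = (\<Prod>d\<in>UNIV - {c}. f t $ d ^ (i $ d))"
      by (rule prod.cong) (auto simp: axis_def)
    then have "monomial (f t) (i - unit_state c)
        = f t $ c ^ (i $ c - 1) * (\<Prod>d\<in>UNIV - {c}. f t $ d ^ (i $ d))"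
      unfolding monomial_def by (subst prod.remove[of UNIV c]) auto
    then show ?thesis by simp
  qed
  ultimately have "((\<lambda>t. monomial (f t) i) has_derivative
      (\<lambda>y. \<Sum>c\<in>UNIV. real (i $ c) * monomial (f t) (i - unit_state c) * f' c * y)) (at t within S)"
    by (simp only: monomial_def[symmetric])
  then show ?thesis
    unfolding has_field_derivative_def sum_distrib_right[symmetric] .
qed

context rooted_branching_immigration
begin

text \<open>Picard iterates, started at \<open>0\<close>, of the equation \<open>u' = B(u)\<close> for the generating functions of
  the branching process at \<open>0\<close>. As they increase with \<open>m\<close>, each of them is a subsolution.\<close>

primrec iterate :: "nat \<Rightarrow> real \<Rightarrow> real ^ 'n" where
  "iterate 0 = (\<lambda>t. 0)"
| "iterate (Suc m) = (\<lambda>t. \<chi> c. exp (- \<beta> c * t) * integral {0..t} (\<lambda>r. exp (\<beta> c * r) * G c (iterate m r)))"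

text \<open>Fixed-point iteration from 0 for \<open>G c u = \<beta> c * u $ c\<close>, which says
  that \<open>u\<close> is a root. Its members will be the limits of the Picard iterates for large
  time.\<close>

primrec iterate_limit :: "nat \<Rightarrow> real ^ 'n" where
  "iterate_limit 0 = 0"
| "iterate_limit (Suc m) = (\<chi> c. G c (iterate_limit m) / \<beta> c)"

lemma cube_if_le_q: "0 \<le> u \<Longrightarrow> u \<le> q \<Longrightarrow> u \<in> {0..1}"
  using q_cube by (auto intro: order_trans)

lemma exp_beta_integral:
  assumes "0 \<le> t"
  shows "((\<lambda>r. exp (\<beta> c * r) * (\<beta> c * q $ c)) has_integral (q $ c * (exp (\<beta> c * t) - 1))) {0..t}"
proof -
  have "((\<lambda>r. q $ c * exp (\<beta> c * r)) has_vector_derivative exp (\<beta> c * r) * (\<beta> c * q $ c)) (at r within {0..t})" for r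
    unfolding has_real_derivative_iff_has_vector_derivative[symmetric]
    by (rule derivative_eq_intros refl)+ simp
  from fundamental_theorem_of_calculus[OF assms this] show ?thesis
    by (simp add: algebra_simps)
qed

text \<open>The upper bound holds since the constant path \<open>q\<close> is stationary and
  \<open>G c\<close> is monotone. Bounds and continuity share one induction, because
  \<open>G c\<close> is known to be continuous only on the cube.\<close>

lemma iterate_bounds_continuous:
  "(\<forall>t\<ge>0. 0 \<le> iterate m t \<and> iterate m t \<le> q) \<and> (\<forall>T. continuous_on {0..T} (iterate m))"
proof (induction m)
  case 0
  then show ?case using q_cube by simp
next
  case (Suc m)
  have c: "continuous_on {0..T} (\<lambda>r. exp (\<beta> c * r) * G c (iterate m r))" for T c
    by (intro continuous_intros continuous_on_compose2[OF continuous_G[of c]])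
      (use Suc cube_if_le_q in auto)
  have "0 \<le> iterate (Suc m) t $ c \<and> iterate (Suc m) t $ c \<le> q $ c" if t: "0 \<le> t" for t c
  proof -
    let ?I = "integral {0..t} (\<lambda>r. exp (\<beta> c * r) * G c (iterate m r))"
    have I: "(\<lambda>r. exp (\<beta> c * r) * G c (iterate m r)) integrable_on {0..t}"
      by (rule integrable_continuous_real) (rule c)
    have cube: "iterate m r \<in> {0..1}" if "r \<in> {0..t}" for r
      using Suc that by (intro cube_if_le_q) auto
    have "0 \<le> ?I"
      by (rule integral_nonneg[OF I]) (simp add: G_nonneg[OF cube])
    have "?I \<le> q $ c * (exp (\<beta> c * t) - 1)"
    proof (rule has_integral_le[OF integrable_integral[OF I] exp_beta_integral[OF t]])
      fix r assume r: "r \<in> {0..t}"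
      have "G c (iterate m r) \<le> G c q"
        using Suc r by (intro G_mono cube q_cube) auto
      then show "exp (\<beta> c * r) * G c (iterate m r) \<le> exp (\<beta> c * r) * (\<beta> c * q $ c)"
        unfolding G_root by (rule mult_left_mono) simp
    qed
    also have "\<dots> \<le> q $ c * exp (\<beta> c * t)" using q_nonneg[of c] by (simp add: algebra_simps)
    finally have "exp (- \<beta> c * t) * ?I \<le> exp (- \<beta> c * t) * (q $ c * exp (\<beta> c * t))"
      by (rule mult_left_mono) simp
    also have "\<dots> = q $ c" by (simp add: mult.left_commute exp_add[symmetric])
    finally show ?thesis using \<open>0 \<le> ?I\<close> by simp
  qed
  then have "\<forall>t\<ge>0. 0 \<le> iterate (Suc m) t \<and> iterate (Suc m) t \<le> q"
    by (simp add: less_eq_vec_def del: iterate.simps)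
  moreover have "continuous_on {0..T} (iterate (Suc m))" for T
    unfolding iterate.simps
    by (intro continuous_on_vec_lambda continuous_intros indefinite_integral_continuous_1
        integrable_continuous_real c)
  ultimately show ?case by blast
qed

lemma iterate_nonneg: "0 \<le> t \<Longrightarrow> 0 \<le> iterate m t"
  and iterate_le_q: "0 \<le> t \<Longrightarrow> iterate m t \<le> q"
  and continuous_iterate: "continuous_on {0..T} (iterate m)"
  using iterate_bounds_continuous[of m] by blast+

lemma iterate_cube: "0 \<le> t \<Longrightarrow> iterate m t \<in> {0..1}"
  by (intro cube_if_le_q iterate_nonneg iterate_le_q)

lemma continuous_G_iterate: "continuous_on {0..T} (\<lambda>r. G c (iterate m r))"
  by (rule continuous_on_compose2[OF continuous_G[of c] continuous_iterate]) (use iterate_cube in auto)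

lemma continuous_A_iterate: "continuous_on {0..T} (\<lambda>r. A (iterate m r))"
  by (rule continuous_on_compose2[OF continuous_A continuous_iterate]) (use iterate_cube in auto)

lemma iterate_mono: "0 \<le> t \<Longrightarrow> iterate m t \<le> iterate (Suc m) t"
proof (induction m arbitrary: t)
  case 0
  then show ?case using iterate_nonneg[of t "Suc 0"] by simp
next
  case (Suc m)
  have "exp (- \<beta> c * t) * integral {0..t} (\<lambda>r. exp (\<beta> c * r) * G c (iterate m r))
      \<le> exp (- \<beta> c * t) * integral {0..t} (\<lambda>r. exp (\<beta> c * r) * G c (iterate (Suc m) r))" for c
    by (intro mult_left_mono integral_le integrable_continuous_real continuous_intros
        continuous_G_iterate G_mono iterate_cube Suc.IH) auto
  then show ?case
    by (simp add: less_eq_vec_def)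
qed

text \<open>Variation of constants again. \<open>G c\<close> is taken at the previous iterate; by
  \<open>iterate_mono\<close> this makes the derivative at most the value of
  \<open>gen_fun b c\<close> at the current one.\<close>

lemma iterate_derivative:
  assumes "t \<in> {0..T}"
  shows "((\<lambda>t. iterate (Suc m) t $ c) has_real_derivative
           (G c (iterate m t) - \<beta> c * iterate (Suc m) t $ c)) (at t within {0..T})"
proof -
  have "((\<lambda>t. integral {0..t} (\<lambda>r. exp (\<beta> c * r) * G c (iterate m r)))
      has_real_derivative exp (\<beta> c * t) * G c (iterate m t)) (at t within {0..T})"
    by (rule integral_has_real_derivative[OF _ assms]) (intro continuous_intros continuous_G_iterate)
  moreover have "((\<lambda>t. exp (- \<beta> c * t)) has_real_derivative exp (- \<beta> c * t) * - \<beta> c) (at t within {0..T})"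
    by (rule derivative_eq_intros refl)+ simp
  ultimately have "((\<lambda>t. exp (- \<beta> c * t) * integral {0..t} (\<lambda>r. exp (\<beta> c * r) * G c (iterate m r)))
      has_real_derivative (exp (- \<beta> c * t) * - \<beta> c * integral {0..t} (\<lambda>r. exp (\<beta> c * r) * G c (iterate m r))
        + exp (\<beta> c * t) * G c (iterate m t) * exp (- \<beta> c * t))) (at t within {0..T})"
    by (intro DERIV_mult)
  then have "((\<lambda>t. iterate (Suc m) t $ c) has_real_derivative
      (exp (- \<beta> c * t) * - \<beta> c * integral {0..t} (\<lambda>r. exp (\<beta> c * r) * G c (iterate m r))
        + exp (\<beta> c * t) * G c (iterate m t) * exp (- \<beta> c * t))) (at t within {0..T})"
    by (simp only: iterate.simps vec_lambda_beta)
  moreover have "exp (\<beta> c * t) * G c (iterate m t) * exp (- \<beta> c * t) = G c (iterate m t)"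
    by (simp add: exp_minus)
  then have "exp (- \<beta> c * t) * - \<beta> c * integral {0..t} (\<lambda>r. exp (\<beta> c * r) * G c (iterate m r))
        + exp (\<beta> c * t) * G c (iterate m t) * exp (- \<beta> c * t)
      = G c (iterate m t) - \<beta> c * iterate (Suc m) t $ c"
    by simp
  ultimately show ?thesis by (rule DERIV_cong)
qed

section \<open>Long-time limits of the iterates and the smallest root\<close>

lemma iterate_limit_bounds:
  "0 \<le> iterate_limit m \<and> iterate_limit m \<le> q \<and> iterate_limit m \<le> iterate_limit (Suc m)"
proof (induction m)
  case 0
  have "0 \<in> {0..1 :: real ^ 'n}" unfolding mem_unit_cube_iff by simp
  then have "0 \<le> G c 0 / \<beta> c" for c
    by (intro divide_nonneg_nonneg G_nonneg less_imp_le[OF beta_pos])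
  then show ?case using q_nonneg by (simp add: less_eq_vec_def)
next
  case (Suc m)
  have le: "iterate_limit (Suc m) \<le> q"
  proof -
    have "G c (iterate_limit m) \<le> \<beta> c * q $ c" for c
      unfolding G_root[symmetric] using Suc by (intro G_mono cube_if_le_q q_cube) auto
    then have "G c (iterate_limit m) / \<beta> c \<le> q $ c" for c
      using beta_pos[of c] by (subst pos_divide_le_eq) (simp_all add: mult.commute)
    then show ?thesis by (simp add: less_eq_vec_def)
  qed
  have nonneg: "0 \<le> iterate_limit (Suc m)" using Suc order_trans by blast
  have "G c (iterate_limit m) / \<beta> c \<le> G c (iterate_limit (Suc m)) / \<beta> c" for c
    using Suc le nonneg less_imp_le[OF beta_pos[of c]]
    by (intro divide_right_mono G_mono cube_if_le_q) auto
  then have "iterate_limit (Suc m) \<le> iterate_limit (Suc (Suc m))"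
    by (simp add: less_eq_vec_def)
  with le nonneg show ?case by blast
qed

lemma iterate_limit_cube: "iterate_limit m \<in> {0..1}"
  using iterate_limit_bounds[of m] by (intro cube_if_le_q) auto

lemma tendsto_compose_cube:
  assumes "continuous_on {0..1} f" "(g \<longlongrightarrow> l) F" "l \<in> {0..1 :: real ^ 'n}" "\<forall>\<^sub>F x in F. g x \<in> {0..1}"
  shows "((\<lambda>x. f (g x)) \<longlongrightarrow> (f l :: real)) F"
  using assms by (rule continuous_on_tendsto_compose)

lemma eventually_iterate_cube: "\<forall>\<^sub>F t in at_top. iterate m t \<in> {0..1}"
  using eventually_ge_at_top[of 0] by eventually_elim (rule iterate_cube)

lemma integral_has_real_derivative_at:
  fixes g :: "real \<Rightarrow> real"
  assumes "\<And>T. continuous_on {0..T} g" "0 < t"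
  shows "((\<lambda>t. integral {0..t} g) has_real_derivative g t) (at t)"
  using integral_has_real_derivative[OF assms(1), of t "t + 1"] assms(2)
  by (simp add: at_within_Icc_at)

text \<open>Each new iterate is an integral divided by \<open>exp (\<beta> c * t)\<close>. By
  l'Hospital its limit is that of \<open>G c (iterate m t) / \<beta> c\<close>, known from the
  induction hypothesis and continuity.\<close>

lemma iterate_tendsto: "(iterate m \<longlongrightarrow> iterate_limit m) at_top"
proof (induction m)
  case (Suc m)
  show ?case
  proof (rule vec_tendstoI)
    fix c
    let ?I = "\<lambda>t. integral {0..t} (\<lambda>r. exp (\<beta> c * r) * G c (iterate m r))"
    have "((\<lambda>t. ?I t / exp (\<beta> c * t)) \<longlongrightarrow> G c (iterate_limit m) / \<beta> c) at_top"
    proof (rule lhospital_at_top_at_top)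
      show "filterlim (\<lambda>t. exp (\<beta> c * t)) at_top at_top"
        using beta_pos[of c]
        by (intro filterlim_compose[OF exp_at_top] filterlim_tendsto_pos_mult_at_top[OF tendsto_const])
          (simp_all add: filterlim_ident)
      show "\<forall>\<^sub>F t in at_top. \<beta> c * exp (\<beta> c * t) \<noteq> 0"
        using beta_pos[of c] by simp
      show "\<forall>\<^sub>F t in at_top. ((\<lambda>t. exp (\<beta> c * t)) has_real_derivative \<beta> c * exp (\<beta> c * t)) (at t)"
        by (intro always_eventually allI) (rule derivative_eq_intros refl | simp)+
      show "\<forall>\<^sub>F t in at_top. (?I has_real_derivative exp (\<beta> c * t) * G c (iterate m t)) (at t)"
        using eventually_gt_at_top[of 0]
        by eventually_elim
          (intro integral_has_real_derivative_at continuous_intros continuous_G_iterate)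
      have "((\<lambda>t. G c (iterate m t) / \<beta> c) \<longlongrightarrow> G c (iterate_limit m) / \<beta> c) at_top"
        using beta_pos[of c]
        by (intro tendsto_divide tendsto_const tendsto_compose_cube[OF continuous_G Suc.IH]
            iterate_limit_cube eventually_iterate_cube) simp
      then show "((\<lambda>t. exp (\<beta> c * t) * G c (iterate m t) / (\<beta> c * exp (\<beta> c * t)))
          \<longlongrightarrow> G c (iterate_limit m) / \<beta> c) at_top" by simp
    qed
    moreover have "?I t / exp (\<beta> c * t) = iterate (Suc m) t $ c" for t
      by (simp add: exp_minus field_simps)
    ultimately show "((\<lambda>t. iterate (Suc m) t $ c) \<longlongrightarrow> iterate_limit (Suc m) $ c) at_top"
      by simp
  qed
qed simp

text \<open>Monotone bounded iteration has a limit below \<open>q\<close>; by continuity the limit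
  is a root, and minimality of \<open>q\<close> forces equality.\<close>

lemma iterate_limit_tendsto:
  assumes smallest: "\<And>u. u \<in> {0..1} \<Longrightarrow> (\<And>c. gen_fun b c u = 0) \<Longrightarrow> q \<le> u"
  shows "iterate_limit \<longlonglongrightarrow> q"
proof -
  have "\<exists>w. (\<lambda>m. iterate_limit m $ c) \<longlonglongrightarrow> w" for c
  proof -
    have "incseq (\<lambda>m. iterate_limit m $ c)"
      using iterate_limit_bounds by (intro incseq_SucI) (auto simp: less_eq_vec_def)
    moreover have "\<forall>m. iterate_limit m $ c \<le> q $ c"
      using iterate_limit_bounds by (auto simp: less_eq_vec_def)
    ultimately show ?thesis by (metis incseq_convergent)
  qed
  then obtain w where w: "\<And>c. (\<lambda>m. iterate_limit m $ c) \<longlonglongrightarrow> w c" by metis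
  define u where "u = (\<chi> c. w c)"
  have u: "iterate_limit \<longlonglongrightarrow> u"
    by (rule vec_tendstoI) (simp add: u_def w)
  have uq: "u \<le> q"
    unfolding less_eq_vec_def u_def using iterate_limit_bounds
    by (auto simp: less_eq_vec_def intro!: LIMSEQ_le_const2[OF w])
  have u0: "0 \<le> u"
    unfolding less_eq_vec_def u_def using iterate_limit_bounds
    by (auto simp: less_eq_vec_def intro!: LIMSEQ_le_const[OF w])
  have cube: "u \<in> {0..1}" by (rule cube_if_le_q) fact+
  have "gen_fun b c u = 0" for c
  proof -
    have "(\<lambda>m. G c (iterate_limit m) / \<beta> c) \<longlonglongrightarrow> G c u / \<beta> c"
      using beta_pos[of c] iterate_limit_cube
      by (intro tendsto_divide tendsto_const tendsto_compose_cube[OF continuous_G u cube]) auto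
    moreover have "(\<lambda>m. iterate_limit (Suc m) $ c) \<longlonglongrightarrow> u $ c"
      using LIMSEQ_Suc[OF w[of c]] by (simp add: u_def)
    ultimately have "G c u / \<beta> c = u $ c"
      by (auto intro: LIMSEQ_unique)
    then show ?thesis
      using beta_pos[of c] by (simp add: gen_fun_eq[OF cube] field_simps)
  qed
  then have "q \<le> u" by (rule smallest[OF cube])
  with uq u show ?thesis by simp
qed

text \<open>With the exact solution of \<open>u' = B(u)\<close>, \<open>u(0) = 0\<close>, in place
  of \<open>iterate m\<close>, this is the classical formula for the probability of being empty at
  time \<open>t\<close>: the power stands for extinction of the families present at the start, the
  exponential for that of the immigrants.\<close>

definition subsolution :: "nat \<Rightarrow> real \<Rightarrow> 'n state \<Rightarrow> real" where
  "subsolution m t i = exp (integral {0..t} (\<lambda>s. A (iterate m s)) + a 0 * t) * monomial (iterate m t) i"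

text \<open>Provides the majorant required by \<open>subsolution_le\<close>: replacing the iterate
  by \<open>q\<close> increases both factors.\<close>

lemma subsolution_upper:
  assumes "0 \<le> t"
  shows "subsolution m t i \<le> exp (- \<mu> * t) * monomial q i"
  unfolding subsolution_def
proof (rule mult_mono)
  have "integral {0..t} (\<lambda>s. A (iterate m s)) \<le> integral {0..t} (\<lambda>s. A q)"
    by (intro integral_le integrable_continuous_real continuous_A_iterate A_mono iterate_cube
        q_cube iterate_le_q) auto
  then show "exp (integral {0..t} (\<lambda>s. A (iterate m s)) + a 0 * t) \<le> exp (- \<mu> * t)"
    using assms by (simp add: algebra_simps)
  show "monomial (iterate m t) i \<le> monomial q i"
    using iterate_nonneg[OF assms, of m] iterate_le_q[OF assms, of m]
    by (intro monomial_mono) (auto simp: less_eq_vec_def)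
qed (auto intro: monomial_unit_cube(1)[OF iterate_cube[OF assms]])

text \<open>Differentiation produces the jump part with \<open>G c\<close> at the previous iterate.
  Monotonicity bounds this by the true jump part, and \<open>backward_step_ge\<close> integrates the
  inequality.\<close>

lemma subsolution_backward:
  assumes "0 \<le> t"
  shows "ennreal (subsolution (Suc m) t i) \<le> (if i = 0 then ennreal (exp (Q i i * t)) else 0)
     + backward_step Q (\<lambda>t k. ennreal (subsolution (Suc m) t k)) t i"
proof -
  let ?E = "\<lambda>t. exp (integral {0..t} (\<lambda>s. A (iterate (Suc m) s)) + a 0 * t)"
  let ?u = "iterate (Suc m)"
  let ?w = "\<lambda>s. ?E s * ((\<Sum>c\<in>UNIV. real (i $ c) * (monomial (?u s) (i - unit_state c) * G c (iterate m s)))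
      + monomial (?u s) i * A (?u s))"
  have "ennreal (subsolution (Suc m) t i)
      \<le> ennreal (exp (Q i i * t) * subsolution (Suc m) 0 i)
       + backward_step Q (\<lambda>t k. ennreal (subsolution (Suc m) t k)) t i"
  proof (rule backward_step_ge[where w = ?w, OF assms])
    fix s assume s: "0 \<le> s" "s \<le> t"
    have cube: "?u s \<in> {0..1}" "iterate m s \<in> {0..1}" by (rule iterate_cube[OF s(1)])+
    show "0 \<le> ?w s"
      using cube by (intro mult_nonneg_nonneg add_nonneg_nonneg sum_nonneg monomial_unit_cube(1)
          G_nonneg A_nonneg) auto
    have "((\<lambda>t. integral {0..t} (\<lambda>s. A (?u s))) has_real_derivative A (?u s)) (at s within {0..t})"
      by (rule integral_has_real_derivative[OF continuous_A_iterate]) (use s in auto)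
    then have E: "(?E has_real_derivative ?E s * (A (?u s) + a 0)) (at s within {0..t})"
      by (auto intro!: derivative_eq_intros)
    have M: "((\<lambda>t. monomial (?u t) i) has_real_derivative
        (\<Sum>c\<in>UNIV. real (i $ c) * monomial (?u s) (i - unit_state c)
           * (G c (iterate m s) - \<beta> c * ?u s $ c))) (at s within {0..t})"
      by (rule has_real_derivative_monomial, rule iterate_derivative) (use s in auto)
    have "real (i $ c) * monomial (?u s) (i - unit_state c) * (G c (iterate m s) - \<beta> c * ?u s $ c)
        = real (i $ c) * (monomial (?u s) (i - unit_state c) * G c (iterate m s))
          - real (i $ c) * \<beta> c * monomial (?u s) i" for c
      using monomial_diff_unit_state[of i c "?u s"]
      by (cases "i $ c = 0") (simp_all add: algebra_simps del: iterate.simps)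
    then have "(\<Sum>c\<in>UNIV. real (i $ c) * monomial (?u s) (i - unit_state c)
           * (G c (iterate m s) - \<beta> c * ?u s $ c))
        = (\<Sum>c\<in>UNIV. real (i $ c) * (monomial (?u s) (i - unit_state c) * G c (iterate m s)))
          - (\<Sum>c\<in>UNIV. real (i $ c) * \<beta> c) * monomial (?u s) i"
      by (simp only: sum_subtractf sum_distrib_right)
    also have "(\<Sum>c\<in>UNIV. real (i $ c) * \<beta> c) = a 0 - Q i i"
      using total_rate[of i] by simp
    finally have eq: "(\<Sum>c\<in>UNIV. real (i $ c) * monomial (?u s) (i - unit_state c)
           * (G c (iterate m s) - \<beta> c * ?u s $ c))
        = (\<Sum>c\<in>UNIV. real (i $ c) * (monomial (?u s) (i - unit_state c) * G c (iterate m s)))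
          - (a 0 - Q i i) * monomial (?u s) i" .
    show "((\<lambda>t. subsolution (Suc m) t i) has_real_derivative (Q i i * subsolution (Suc m) s i + ?w s))
        (at s within {0..t})"
      unfolding subsolution_def
      by (rule DERIV_cong[OF DERIV_mult[OF E M]], unfold eq) (simp add: algebra_simps del: iterate.simps)
    have "ennreal (?w s) \<le> ennreal (?E s * ((\<Sum>c\<in>UNIV. real (i $ c) * (monomial (?u s) (i - unit_state c) * G c (?u s)))
      + monomial (?u s) i * A (?u s)))"
      using cube iterate_mono[OF s(1), of m]
      by (intro ennreal_leI mult_left_mono add_right_mono sum_mono monomial_unit_cube(1) G_mono) auto
    also have "\<dots> = offdiag_sum Q (\<lambda>k. ennreal (?E s) * ennreal (monomial (?u s) k)) i"
      unfolding offdiag_sum_cmult offdiag_sum_monomial[OF cube(1)]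
      by (rule ennreal_mult') simp
    also have "\<dots> = offdiag_sum Q (\<lambda>k. ennreal (subsolution (Suc m) s k)) i"
      by (simp add: subsolution_def ennreal_mult' del: iterate.simps)
    finally show "ennreal (?w s) \<le> offdiag_sum Q (\<lambda>k. ennreal (subsolution (Suc m) s k)) i" .
  qed
  \<comment> \<open>The iterates start at 0, and \<open>0 ^ 0 = 1\<close> makes
    \<open>monomial 0\<close> the indicator of the empty state, which is the target.\<close>
  moreover have "subsolution (Suc m) 0 i = (if i = 0 then 1 else 0)"
  proof -
    have 0: "?u 0 = 0" by (simp add: vec_eq_iff)
    have "monomial 0 i = (if i = 0 then 1 else 0 :: real)"
      by (auto simp: monomial_def vec_eq_iff)
    then show ?thesis by (simp add: subsolution_def 0 del: iterate.simps)
  qed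
  ultimately show ?thesis by (auto split: if_splits)
qed

text \<open>At the empty state the monomial is 1, so the logarithm is the exponent alone; the time
  average of \<open>A\<close> along the iterate has the same limit as \<open>A\<close>
  itself.\<close>

lemma ln_subsolution_tendsto:
  "((\<lambda>t. ln (subsolution m t 0) / t) \<longlongrightarrow> A (iterate_limit m) + a 0) at_top"
proof -
  have "((\<lambda>t. integral {0..t} (\<lambda>s. A (iterate m s)) / t) \<longlongrightarrow> A (iterate_limit m)) at_top"
  proof (rule lhospital_at_top_at_top[where g' = "\<lambda>_. 1"])
    show "\<forall>\<^sub>F t in at_top. ((\<lambda>t. integral {0..t} (\<lambda>s. A (iterate m s))) has_real_derivative A (iterate m t)) (at t)"
      using eventually_gt_at_top[of 0]
      by eventually_elim (intro integral_has_real_derivative_at continuous_A_iterate)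
    show "((\<lambda>t. A (iterate m t) / 1) \<longlongrightarrow> A (iterate_limit m)) at_top"
      using tendsto_compose_cube[OF continuous_A iterate_tendsto iterate_limit_cube eventually_iterate_cube]
      by simp
  qed (auto simp: filterlim_ident)
  then have "((\<lambda>t. integral {0..t} (\<lambda>s. A (iterate m s)) / t + a 0) \<longlongrightarrow> A (iterate_limit m) + a 0) at_top"
    by (intro tendsto_intros)
  moreover have "\<forall>\<^sub>F t in at_top. integral {0..t} (\<lambda>s. A (iterate m s)) / t + a 0 = ln (subsolution m t 0) / t"
    using eventually_gt_at_top[of 0]
    by eventually_elim (simp add: subsolution_def add_divide_distrib)
  ultimately show ?thesis by (rule Lim_transform_eventually)
qed

end

section \<open>Invariance and the decay parameter\<close>

context weighted_q_matrix
begin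

lemma feller_limit_le:
  assumes "0 \<le> t"
  shows "(SUP m. feller_iter Q m t i j) * ennreal (y j) \<le> ennreal (exp (- \<mu> * t) * y i)"
  unfolding SUP_mult_right_ennreal by (intro SUP_least feller_iter_le[OF assms])

text \<open>\<open>enn2real\<close> sends infinity to 0, so finiteness has to be shown; it follows
  from the mass bound where \<open>y j\<close> is positive.\<close>

lemma ennreal_feller_minimal:
  assumes "0 \<le> t" "0 < y j"
  shows "ennreal (feller_minimal Q t i j) = (SUP m. feller_iter Q m t i j)"
proof -
  have "(SUP m. feller_iter Q m t i j) \<noteq> top"
  proof
    assume "(SUP m. feller_iter Q m t i j) = top"
    with feller_limit_le[OF assms(1), of i j] assms(2) show False
      by (simp add: ennreal_top_mult top_unique)
  qed
  then show ?thesis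
    unfolding feller_minimal_def by (intro ennreal_enn2real) (simp only: less_top)
qed

lemma feller_minimal_nonneg: "0 \<le> feller_minimal Q t i j"
  by (simp add: feller_minimal_def)

lemma feller_minimal_le:
  assumes "0 \<le> t" "0 < y j"
  shows "feller_minimal Q t i j * y j \<le> exp (- \<mu> * t) * y i"
proof -
  have "ennreal (feller_minimal Q t i j * y j) \<le> ennreal (exp (- \<mu> * t) * y i)"
    using feller_limit_le[OF assms(1), of i j]
    by (simp add: ennreal_feller_minimal[OF assms] ennreal_mult'' y_nonneg)
  then show ?thesis by (simp add: y_nonneg)
qed

lemma feller_minimal_has_sum:
  assumes "0 \<le> t" and pos: "\<And>j. 0 < y j" and "(\<lambda>m. defect m t i) \<longlonglongrightarrow> 0"
  shows "((\<lambda>j. feller_minimal Q t i j * y j) has_sum (exp (- \<mu> * t) * y i)) UNIV"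
proof (rule has_sum_if_nn_integral)
  show "(\<integral>\<^sup>+j. ennreal (feller_minimal Q t i j * y j) \<partial>count_space UNIV) = ennreal (exp (- \<mu> * t) * y i)"
    using nn_integral_feller_limit[OF assms(1,3)]
    by (simp add: ennreal_mult'' y_nonneg ennreal_feller_minimal[OF assms(1) pos])
qed (simp_all add: feller_minimal_nonneg y_nonneg)

end

theorem theorem6p3:
  fixes a :: "'n::finite state \<Rightarrow> real"
    and b :: "'n \<Rightarrow> 'n state \<Rightarrow> real"
    and Q :: "'n state \<Rightarrow> 'n state \<Rightarrow> real"
    and P :: "real \<Rightarrow> 'n state \<Rightarrow> 'n state \<Rightarrow> real"
    and lambda_Z :: real
    and q :: "real ^ 'n"
    and y :: "'n state \<Rightarrow> real"
  assumes "immigration_rates a" and "branching_rates b"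
    and Q: "Q = q_matrix a b" and "conservative Q"
    and P: "P = feller_minimal Q" and "communicating P"
    and A1: "nonsingular b"
    and A2: "\<forall>i j. has_finite_partial (gen_fun b i) j 1"
    and A3: "positively_regular (G_matrix b 1)"
    and "is_decay_parameter P lambda_Z"
    and "is_smallest_root b q"
    and y: "\<forall>j. y j = (\<Prod>k\<in>UNIV. (q $ k) ^ (j $ k))"
  shows "invariant_vector_q Q lambda_Z y \<and> invariant_vector_transition P lambda_Z y"
proof -
  have y_eq: "y = monomial q"
    using y by (auto simp: monomial_def)
  interpret B: rooted_branching_immigration a b q
    using assms(1,2) \<open>is_smallest_root b q\<close>
    by unfold_locales (auto simp: is_smallest_root_def)
  define \<mu> where "\<mu> = - a 0 - punctured_gf a 0 q"
  have P_eq: "P = feller_minimal (q_matrix a b)" by (simp add: P Q)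
  \<comment> \<open>Since \<open>monomial q 0 = 1\<close>, the mass bound limits the probability of
    passing from one particle of type \<open>c\<close> to the empty state by a multiple of
    \<open>q $ c\<close>; by communication it is positive at some time.\<close>
  have q_pos: "0 < q $ c" for c
  proof -
    obtain t where t: "0 \<le> t" "0 < P t (unit_state c) 0"
      using \<open>communicating P\<close> unfolding communicating_def by blast
    from t(2) have "0 < exp (- \<mu> * t) * q $ c"
      using B.feller_minimal_le[OF t(1), of 0 "unit_state c"] by (simp add: P_eq \<mu>_def)
    then show ?thesis by (simp add: zero_less_mult_iff)
  qed
  have y_pos: "0 < monomial q j" for j
    unfolding monomial_def by (intro prod_pos zero_less_power q_pos)
  have mean: "(\<lambda>l. b c l * real (l $ j)) summable_on (UNIV - {unit_state c})" for c j
    using A2 by (intro B.mean_summable) blast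
  have defect: "(\<lambda>m. B.defect m t i) \<longlonglongrightarrow> 0" if "0 \<le> t" for t i
    by (rule B.defect_vanishes[OF q_pos mean that])
  have decay: "((\<lambda>t. ln (P t 0 0) / t) \<longlongrightarrow> - lambda_Z) at_top"
    using \<open>is_decay_parameter P lambda_Z\<close> by (simp add: is_decay_parameter_def)
  have lower: "B.subsolution (Suc m) t 0 \<le> P t 0 0" if "0 \<le> t" for m t
  proof -
    have "ennreal (B.subsolution (Suc m) t 0) \<le> (SUP m. feller_iter (q_matrix a b) m t 0 0)"
      by (rule B.subsolution_le_feller_limit[OF B.subsolution_upper B.subsolution_backward that defect[OF that]])
    also have "\<dots> = ennreal (P t 0 0)"
      unfolding P_eq by (rule B.ennreal_feller_minimal[symmetric, OF that y_pos])
    finally show ?thesis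
      using B.feller_minimal_nonneg by (simp add: P_eq)
  qed
  have sub_pos: "0 < B.subsolution m t 0" for m t
    by (simp add: B.subsolution_def)
  have "lambda_Z = \<mu>"
  proof (rule antisym)
    \<comment> \<open>Time goes to infinity for fixed \<open>m\<close>; only afterwards does
      \<open>m\<close> grow and \<open>iterate_limit\<close> approach \<open>q\<close>. Smallness of
      the root is used in that second limit.\<close>
    have le: "punctured_gf a 0 (B.iterate_limit (Suc m)) + a 0 \<le> - lambda_Z" for m
    proof (rule tendsto_le[OF _ decay B.ln_subsolution_tendsto])
      show "\<forall>\<^sub>F t in at_top. ln (B.subsolution (Suc m) t 0) / t \<le> ln (P t 0 0) / t"
        using eventually_gt_at_top[of 0]
      proof eventually_elim
        case (elim t)
        then show ?case
          using lower[of t m] sub_pos[of "Suc m" t]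
          by (intro divide_right_mono) (auto intro: ln_mono less_le_trans)
      qed
    qed simp
    have "(\<lambda>m. punctured_gf a 0 (B.iterate_limit (Suc m)) + a 0) \<longlonglongrightarrow> punctured_gf a 0 q + a 0"
    proof (intro tendsto_add tendsto_const LIMSEQ_Suc)
      have "B.iterate_limit \<longlonglongrightarrow> q"
        using \<open>is_smallest_root b q\<close> by (intro B.iterate_limit_tendsto) (auto simp: is_smallest_root_def)
      then show "(\<lambda>m. punctured_gf a 0 (B.iterate_limit m)) \<longlonglongrightarrow> punctured_gf a 0 q"
        by (rule B.tendsto_compose_cube[OF B.continuous_A])
          (simp_all only: B.q_cube B.iterate_limit_cube eventually_True)
    qed
    then have "punctured_gf a 0 q + a 0 \<le> - lambda_Z"
      by (rule LIMSEQ_le_const2) (use le in blast)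
    then show "lambda_Z \<le> \<mu>" by (simp add: \<mu>_def)
  next
    \<comment> \<open>The reverse bound is the mass bound at the empty state, where the weight is 1;
      the subsolution also gives the positivity needed to take logarithms.\<close>
    have "- lambda_Z \<le> - \<mu>"
    proof (rule tendsto_upperbound[OF decay])
      show "\<forall>\<^sub>F t in at_top. ln (P t 0 0) / t \<le> - \<mu>"
        using eventually_gt_at_top[of 0]
      proof eventually_elim
        case (elim t)
        have "P t 0 0 \<le> exp (- \<mu> * t)"
          using B.feller_minimal_le[of t 0 0] elim by (simp add: P_eq \<mu>_def)
        moreover have "0 < P t 0 0"
          using lower[of t 0] sub_pos[of "Suc 0" t] elim by simp
        ultimately have "ln (P t 0 0) \<le> - \<mu> * t"
          by (metis ln_exp ln_mono)
        then show ?case using elim by (simp add: field_simps)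
      qed
    qed simp
    then show "\<mu> \<le> lambda_Z" by simp
  qed
  moreover have "invariant_vector_q Q \<mu> y"
    using B.Q_monomial_has_sum y_pos by (simp add: invariant_vector_q_def y_eq Q \<mu>_def)
  moreover have "invariant_vector_transition P \<mu> y"
    using B.feller_minimal_has_sum[OF _ y_pos defect] y_pos
    by (simp add: invariant_vector_transition_def y_eq P_eq \<mu>_def)
  ultimately show ?thesis by simp
qed

end
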